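(* Let $\Lambda$ be a countable character rigid group having at most countably many finite-dimensional unitary representations (up to equivalence). Then every ergodic probability measure preserving action $\Lambda\curvearrowright(X,\mu)$ is either essentially transitive or satisfies $\mu(\mathrm{Fix}(g))=0$ for every $g\in\Lambda\setminus\mathrm{Z}(\Lambda)$.
   Context: For a countable group, a trace is a positive definite, conjugation invariant function $\varphi$ with $\varphi(e)=1$; characters are the extreme points of the convex set of traces; a character is finite-dimensional if it is $\frac{1}{\dim\pi}\mathrm{tr}\circ\pi$ for a finite-dimensional irreducible unitary representation $\pi$. A group is character rigid if every character is either finite-dimensional or vanishes outside its center. $\mathrm{Fix}(g)=\{x\in X:gx=x\}$. *)

theory Defs
  imports "HOL-Probability.Probability" "HOL-Algebra.Group" "Jordan_Normal_Form.Matrix"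
begin

definition center :: "('a, 'b) monoid_scheme \<Rightarrow> 'a set" where
  "center G = {z \<in> carrier G. \<forall>g \<in> carrier G. z \<otimes>\<^bsub>G\<^esub> g = g \<otimes>\<^bsub>G\<^esub> z}"

definition positive_definite :: "('a, 'b) monoid_scheme \<Rightarrow> ('a \<Rightarrow> complex) \<Rightarrow> bool" where
  "positive_definite G \<phi> \<longleftrightarrow>
     (\<forall>(n::nat) (c::nat \<Rightarrow> complex) (g::nat \<Rightarrow> 'a). (\<forall>i<n. g i \<in> carrier G) \<longrightarrow>
        (let s = (\<Sum>i<n. \<Sum>j<n. cnj (c i) * c j * \<phi> (inv\<^bsub>G\<^esub> (g i) \<otimes>\<^bsub>G\<^esub> g j))
         in Im s = 0 \<and> Re s \<ge> 0))"

definition conj_invariant :: "('a, 'b) monoid_scheme \<Rightarrow> ('a \<Rightarrow> complex) \<Rightarrow> bool" where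
  "conj_invariant G \<phi> \<longleftrightarrow>
     (\<forall>g \<in> carrier G. \<forall>h \<in> carrier G. \<phi> (h \<otimes>\<^bsub>G\<^esub> g \<otimes>\<^bsub>G\<^esub> inv\<^bsub>G\<^esub> h) = \<phi> g)"

definition is_trace :: "('a, 'b) monoid_scheme \<Rightarrow> ('a \<Rightarrow> complex) \<Rightarrow> bool" where
  "is_trace G \<phi> \<longleftrightarrow> positive_definite G \<phi> \<and> conj_invariant G \<phi> \<and> \<phi> \<one>\<^bsub>G\<^esub> = 1"

text \<open>Characters are the extreme points of the convex set of traces (functions are
  compared on the carrier of the group only).\<close>
definition is_character :: "('a, 'b) monoid_scheme \<Rightarrow> ('a \<Rightarrow> complex) \<Rightarrow> bool" where
  "is_character G \<phi> \<longleftrightarrow> is_trace G \<phi> \<and>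
     (\<forall>\<psi>1 \<psi>2 (t::real). is_trace G \<psi>1 \<and> is_trace G \<psi>2 \<and> 0 < t \<and> t < 1 \<and>
        (\<forall>g \<in> carrier G. \<phi> g = complex_of_real t * \<psi>1 g + complex_of_real (1 - t) * \<psi>2 g)
        \<longrightarrow> (\<forall>g \<in> carrier G. \<psi>1 g = \<phi> g \<and> \<psi>2 g = \<phi> g))"

definition adj_mat :: "complex mat \<Rightarrow> complex mat" where
  "adj_mat A = transpose_mat (map_mat cnj A)"

definition unitary_mat :: "nat \<Rightarrow> complex mat \<Rightarrow> bool" where
  "unitary_mat n A \<longleftrightarrow> A \<in> carrier_mat n n \<and> A * adj_mat A = 1\<^sub>m n \<and> adj_mat A * A = 1\<^sub>m n"

definition mat_trace :: "complex mat \<Rightarrow> complex" where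
  "mat_trace A = (\<Sum>i<dim_row A. A $$ (i, i))"

definition unitary_rep :: "('a, 'b) monoid_scheme \<Rightarrow> nat \<Rightarrow> ('a \<Rightarrow> complex mat) \<Rightarrow> bool" where
  "unitary_rep G n \<pi> \<longleftrightarrow>
     (\<forall>g \<in> carrier G. unitary_mat n (\<pi> g)) \<and>
     (\<forall>g \<in> carrier G. \<forall>h \<in> carrier G. \<pi> (g \<otimes>\<^bsub>G\<^esub> h) = \<pi> g * \<pi> h)"

definition linear_subspace_vec :: "nat \<Rightarrow> complex vec set \<Rightarrow> bool" where
  "linear_subspace_vec n W \<longleftrightarrow> W \<subseteq> carrier_vec n \<and> 0\<^sub>v n \<in> W \<and>
     (\<forall>v \<in> W. \<forall>w \<in> W. v + w \<in> W) \<and> (\<forall>c. \<forall>v \<in> W. c \<cdot>\<^sub>v v \<in> W)"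

definition irreducible_rep :: "('a, 'b) monoid_scheme \<Rightarrow> nat \<Rightarrow> ('a \<Rightarrow> complex mat) \<Rightarrow> bool" where
  "irreducible_rep G n \<pi> \<longleftrightarrow> unitary_rep G n \<pi> \<and> n \<ge> 1 \<and>
     (\<forall>W. linear_subspace_vec n W \<and> (\<forall>g \<in> carrier G. \<forall>w \<in> W. \<pi> g *\<^sub>v w \<in> W)
          \<longrightarrow> W = {0\<^sub>v n} \<or> W = carrier_vec n)"

definition equiv_rep :: "('a, 'b) monoid_scheme \<Rightarrow> nat \<times> ('a \<Rightarrow> complex mat) \<Rightarrow> nat \<times> ('a \<Rightarrow> complex mat) \<Rightarrow> bool" where
  "equiv_rep G p q \<longleftrightarrow> fst p = fst q \<and>
     (\<exists>U. unitary_mat (fst p) U \<and> (\<forall>g \<in> carrier G. U * snd p g = snd q g * U))"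

definition countably_many_fd_reps :: "('a, 'b) monoid_scheme \<Rightarrow> bool" where
  "countably_many_fd_reps G \<longleftrightarrow>
     (\<exists>S. countable S \<and> (\<forall>(n, \<pi>) \<in> S. unitary_rep G n \<pi>) \<and>
        (\<forall>n \<pi>. unitary_rep G n \<pi> \<longrightarrow> (\<exists>q \<in> S. equiv_rep G (n, \<pi>) q)))"

definition finite_dim_character :: "('a, 'b) monoid_scheme \<Rightarrow> ('a \<Rightarrow> complex) \<Rightarrow> bool" where
  "finite_dim_character G \<phi> \<longleftrightarrow>
     (\<exists>n \<pi>. irreducible_rep G n \<pi> \<and> (\<forall>g \<in> carrier G. \<phi> g = mat_trace (\<pi> g) / of_nat n))"

definition character_rigid :: "('a, 'b) monoid_scheme \<Rightarrow> bool" where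
  "character_rigid G \<longleftrightarrow>
     (\<forall>\<phi>. is_character G \<phi> \<longrightarrow>
        finite_dim_character G \<phi> \<or> (\<forall>g \<in> carrier G - center G. \<phi> g = 0))"

definition pmp_action :: "('a, 'b) monoid_scheme \<Rightarrow> ('a \<Rightarrow> 'x \<Rightarrow> 'x) \<Rightarrow> 'x measure \<Rightarrow> bool" where
  "pmp_action G T M \<longleftrightarrow> prob_space M \<and>
     (\<forall>g \<in> carrier G. T g \<in> M \<rightarrow>\<^sub>M M \<and> distr M M (T g) = M) \<and>
     (\<forall>x \<in> space M. T \<one>\<^bsub>G\<^esub> x = x) \<and>
     (\<forall>g \<in> carrier G. \<forall>h \<in> carrier G. \<forall>x \<in> space M. T (g \<otimes>\<^bsub>G\<^esub> h) x = T g (T h x))"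

definition ergodic_action :: "('a, 'b) monoid_scheme \<Rightarrow> ('a \<Rightarrow> 'x \<Rightarrow> 'x) \<Rightarrow> 'x measure \<Rightarrow> bool" where
  "ergodic_action G T M \<longleftrightarrow>
     (\<forall>A \<in> sets M. (\<forall>g \<in> carrier G. T g -` A \<inter> space M = A) \<longrightarrow>
        measure M A = 0 \<or> measure M A = 1)"

definition orbit :: "('a, 'b) monoid_scheme \<Rightarrow> ('a \<Rightarrow> 'x \<Rightarrow> 'x) \<Rightarrow> 'x \<Rightarrow> 'x set" where
  "orbit G T x = (\<lambda>g. T g x) ` carrier G"

definition essentially_transitive :: "('a, 'b) monoid_scheme \<Rightarrow> ('a \<Rightarrow> 'x \<Rightarrow> 'x) \<Rightarrow> 'x measure \<Rightarrow> bool" where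
  "essentially_transitive G T M \<longleftrightarrow>
     (\<exists>x \<in> space M. orbit G T x \<in> sets M \<and> measure M (orbit G T x) = 1)"

definition Fix :: "('a \<Rightarrow> 'x \<Rightarrow> 'x) \<Rightarrow> 'x measure \<Rightarrow> 'a \<Rightarrow> 'x set" where
  "Fix T M g = {x \<in> space M. T g x = x}"

end

theory Submission
  imports Defs
begin

text \<open>
  The function \<open>\<phi> g = \<mu>(Fix g)\<close> is a trace, so by Choquet's theorem it is an integral of
  characters. If \<open>\<phi>\<close> is nonzero at some noncentral element, then by rigidity and
  countability one finite-dimensional character \<open>\<xi> = tr \<circ> \<pi> / n\<close> carries positive mass \<open>\<alpha>\<close>,
  so that \<open>\<phi> - \<alpha> \<xi>\<close> is positive definite. Multiplying by the conjugate of \<open>\<xi>\<close> gives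
  \<open>\<Sum>i,j<k. \<phi>(g\<^sub>i\<inverse> g\<^sub>j) \<ge> \<alpha> k\<^sup>2 / n\<^sup>2\<close> for all group elements \<open>g\<^sub>1, \<dots>, g\<^sub>k\<close>.
  The left side is the integral over \<open>x\<close> of the number of coincidences \<open>g\<^sub>i x = g\<^sub>j x\<close>, and if almost
  all orbits are infinite its infimum after division by \<open>k\<^sup>2\<close> is 0, since near-minimisers are nearly
  invariant under translation. Hence finite orbits have positive measure, so full measure by
  ergodicity, and an ergodic action with finite orbits is concentrated on one orbit.
\<close>

section \<open>Compact sets of sequences as images of compact sets of reals\<close>

text \<open>The lower bound has to survive cancellation: for a nontrivial \<pi> the values of \<xi>
  may sum to 0, so constant coefficients in the form of \<phi> - \<alpha> \<xi> prove nothing. The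
  Schur product with the conjugate turns \<xi> into its squared modulus, whose double sum is at
  least k^2 / n^2 because \<xi> is the Gram kernel of unit vectors in dimension n^2. The normalised
  coincidence count is a squared Hilbert space norm: each g gives the field of point masses at g x,
  and a list of group elements gives their average, with repetitions acting as rational weights. The
  element of least norm in the closed convex hull is invariant, and an invariant square summable
  function on an infinite orbit is 0; the proof is a quantitative form of this for finite lists. For
  Choquet's theorem the compact set of traces is parametrised by a compact set of reals. The affine
  structure is then visible only through coordinate functions, but Helly's selection theorem
  supplies weak limits of probability measures.\<close>

lemma compact_binary_sequences: "compact {b :: nat \<Rightarrow> real. \<forall>k. b k \<in> {0, 1}}"
proof -
  have "{b :: nat \<Rightarrow> real. \<forall>k. b k \<in> {0, 1}} = PiE UNIV (\<lambda>_. {0, 1})" by (auto simp: PiE_def Pi_def)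
  moreover have "compactin (product_topology (\<lambda>_. euclidean) (UNIV :: nat set)) (PiE UNIV (\<lambda>_. {0, 1 :: real}))"
    by (subst compactin_PiE) (auto intro: finite_imp_compact)
  ultimately show ?thesis by (simp add: euclidean_product_topology)
qed

text \<open>Weierstrass M-test with majorant r^k. The index map \<open>i\<close> covers both a whole
  sequence and a single row of a sequence read as a two-dimensional array.\<close>

lemma continuous_on_binary_series:
  fixes r :: real
  assumes "0 \<le> r" "r < 1"
  shows "continuous_on {b :: nat \<Rightarrow> real. \<forall>k. b k \<in> {0, 1}} (\<lambda>b. \<Sum>k. b (i k) * r ^ k)"
proof -
  let ?D = "{b :: nat \<Rightarrow> real. \<forall>k. b k \<in> {0, 1}}"
  have b: "norm (b (i k) * r ^ k) \<le> r ^ k" if "b \<in> ?D" for b k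
  proof -
    have "b (i k) = 0 \<or> b (i k) = 1" using that by auto
    then show ?thesis using assms by auto
  qed
  have "uniform_limit ?D (\<lambda>n b. \<Sum>k<n. b (i k) * r ^ k) (\<lambda>b. \<Sum>k. b (i k) * r ^ k) sequentially"
    by (rule Weierstrass_m_test[OF b]) (use assms in auto)
  then show ?thesis
  proof (rule uniform_limit_theorem[rotated])
    show "\<forall>\<^sub>F n in sequentially. continuous_on ?D (\<lambda>b. \<Sum>k<n. b (i k) * r ^ k)"
      by (intro always_eventually allI continuous_intros continuous_on_subset[OF continuous_on_product_coordinates]) auto
  qed simp
qed

text \<open>At the first index m where two sequences differ the terms differ by (1/3)^m, while all
  later terms together contribute at most half of that. Ratio 1/2 would allow equality, as for the
  two expansions of a dyadic rational.\<close>

lemma inj_on_ternary_series: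
  "inj_on (\<lambda>b. \<Sum>k. b k * (1/3) ^ k) {b :: nat \<Rightarrow> real. \<forall>k. b k \<in> {0, 1}}"
proof (rule inj_onI, rule ccontr)
  fix b c :: "nat \<Rightarrow> real"
  assume b: "b \<in> {b. \<forall>k. b k \<in> {0, 1}}" and c: "c \<in> {b. \<forall>k. b k \<in> {0, 1}}"
    and eq: "(\<Sum>k. b k * (1/3) ^ k) = (\<Sum>k. c k * (1/3) ^ k)" and ne: "b \<noteq> c"
  have bs: "b k = 0 \<or> b k = 1" and cs: "c k = 0 \<or> c k = 1" for k using b c by auto
  define m where "m = (LEAST k. b k \<noteq> c k)"
  obtain k0 where "b k0 \<noteq> c k0" using ne by auto
  then have m: "b m \<noteq> c m" unfolding m_def by (rule LeastI)
  have lt: "b k = c k" if "k < m" for k using that not_less_Least unfolding m_def by blast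
  have sg: "summable (\<lambda>k. (1/3::real) ^ k)" by (rule summable_geometric) simp
  have d: "\<bar>b k - c k\<bar> \<le> 1" for k using bs[of k] cs[of k] by auto
  have bb: "\<bar>b k\<bar> \<le> 1" and cb: "\<bar>c k\<bar> \<le> 1" for k using bs[of k] cs[of k] by auto
  have n: "norm (f k * (1/3) ^ k) \<le> (1/3) ^ k" if "\<bar>f k\<bar> \<le> 1" for f :: "nat \<Rightarrow> real" and k
    using that by (simp add: abs_mult mult_le_cancel_right1)
  have sb: "summable (\<lambda>k. b k * (1/3) ^ k)"
    by (rule summable_comparison_test'[OF sg], rule n) (rule bb)
  have sc: "summable (\<lambda>k. c k * (1/3) ^ k)"
    by (rule summable_comparison_test'[OF sg], rule n) (rule cb)
  define f where "f k = (b k - c k) * (1/3) ^ k" for k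
  have sf: "summable f" unfolding f_def by (rule summable_comparison_test'[OF sg], rule n[OF d])
  have "0 = suminf f"
    using eq suminf_diff[OF sb sc] by (simp add: f_def[abs_def] left_diff_distrib)
  also have "\<dots> = (\<Sum>k. f (k + Suc m)) + (\<Sum>k<Suc m. f k)"
    by (rule suminf_split_initial_segment[OF sf])
  also have "(\<Sum>k<Suc m. f k) = f m" using lt by (simp add: f_def)
  finally have "\<bar>f m\<bar> = \<bar>\<Sum>k. f (k + Suc m)\<bar>" by linarith
  also have "\<dots> \<le> (\<Sum>k. (1/3) ^ Suc m * (1/3) ^ k)"
  proof -
    have s: "summable (\<lambda>k. (1/3::real) ^ Suc m * (1/3) ^ k)" by (intro summable_mult sg)
    have nb: "norm (f (k + Suc m)) \<le> (1/3) ^ Suc m * (1/3) ^ k" for k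
      using n[of "\<lambda>k. b k - c k" "k + Suc m", OF d] by (simp add: f_def power_add mult_ac)
    have "norm (\<Sum>k. f (k + Suc m)) \<le> (\<Sum>k. (1/3) ^ Suc m * (1/3) ^ k)"
      by (rule norm_suminf_le[OF nb s])
    then show ?thesis by simp
  qed
  also have "\<dots> = (1/3) ^ Suc m * (3/2)"
    by (subst suminf_mult[OF sg]) (simp add: suminf_geometric)
  also have "\<dots> < (1/3) ^ m" by simp
  also have "(1/3) ^ m = \<bar>f m\<bar>"
  proof -
    have "\<bar>b m - c m\<bar> = 1" using m bs[of m] cs[of m] by auto
    then show ?thesis by (simp add: f_def abs_mult)
  qed
  finally show False by simp
qed

text \<open>Greedy digits: the remainder \<open>r k\<close> stays between 0 and 2 (1/2)^k. The
  target is 2 x because the series starts at k = 0 and so ranges over [0, 2].\<close>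

lemma binary_expansion:
  fixes x :: real
  assumes "0 \<le> x" "x \<le> 1"
  obtains b :: "nat \<Rightarrow> real" where "\<And>k. b k \<in> {0, 1}" "(\<Sum>k. b k * (1/2) ^ k) = 2 * x"
proof -
  define r where "r = rec_nat (2 * x) (\<lambda>k r. if (1/2) ^ k \<le> r then r - (1/2) ^ k else (r::real))"
  define b :: "nat \<Rightarrow> real" where "b k = (if (1/2) ^ k \<le> r k then 1 else 0)" for k
  have r0: "r 0 = 2 * x" by (simp add: r_def)
  have rS: "r (Suc k) = r k - b k * (1/2) ^ k" for k by (simp add: r_def b_def)
  have rb: "0 \<le> r k \<and> r k \<le> 2 * (1/2) ^ k" for k
    by (induction k) (use assms in \<open>auto simp: r0 rS b_def\<close>)
  have ps: "(\<Sum>k<n. b k * (1/2) ^ k) = 2 * x - r n" for n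
    by (induction n) (auto simp: r0 rS)
  have "(\<lambda>k. 2 * (1/2::real) ^ k) \<longlonglongrightarrow> 2 * 0"
    by (intro tendsto_mult tendsto_const LIMSEQ_power_zero) simp
  then have r: "r \<longlonglongrightarrow> 0"
    by (intro tendsto_sandwich[OF _ _ tendsto_const, of 0 r sequentially "\<lambda>k. 2 * (1/2::real) ^ k"]) (use rb in auto)
  have "(\<lambda>k. b k * (1/2) ^ k) sums (2 * x)"
    unfolding sums_def ps using tendsto_diff[OF tendsto_const r, of "2 * x"] by simp
  then have "(\<Sum>k. b k * (1/2) ^ k) = 2 * x" by (rule sums_unique[symmetric])
  then show ?thesis using that[of b] by (auto simp: b_def)
qed

text \<open>A form of the Hausdorff-Alexandroff theorem: the space of binary sequences maps
  continuously onto the sequences in [-1, 1] and embeds in the line by ternary series. The part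
  lying over \<open>K\<close> is compact; \<open>C\<close> is its ternary image, and
  \<open>s\<close> undoes the embedding and applies the surjection.\<close>

lemma compact_sequences_image_of_compact_real:
  fixes K :: "(nat \<Rightarrow> real) set"
  assumes "compact K" "\<And>p n. p \<in> K \<Longrightarrow> \<bar>p n\<bar> \<le> 1"
  obtains C and s :: "real \<Rightarrow> nat \<Rightarrow> real"
  where "compact C" "continuous_on C s" "s ` C = K"
proof -
  define D where "D = {b :: nat \<Rightarrow> real. \<forall>k. b k \<in> {0, 1}}"
  \<comment> \<open>Row n of the array holds the binary digits of coordinate n; the series lies in
    [0, 2], hence the shift by 1.\<close>
  define t where "t b = (\<lambda>n. (\<Sum>k. b (prod_encode (n, k)) * (1/2) ^ k) - 1)" for b :: "nat \<Rightarrow> real"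
  define e where "e b = (\<Sum>k. b k * (1/3) ^ k)" for b :: "nat \<Rightarrow> real"
  have ct: "continuous_on D t"
    unfolding t_def D_def
    by (intro continuous_on_coordinatewise_then_product continuous_on_diff continuous_on_const
        continuous_on_binary_series) auto
  have ce: "continuous_on D e"
    unfolding e_def D_def by (rule continuous_on_binary_series) auto
  have cD: "compact D" unfolding D_def by (rule compact_binary_sequences)
  define D' where "D' = D \<inter> t -` K"
  have surj: "t ` D' = K"
  proof (intro equalityI subsetI)
    fix p assume p: "p \<in> K"
    have "\<exists>b. (\<forall>k. b k \<in> {0, 1::real}) \<and> (\<Sum>k. b k * (1/2) ^ k) = 2 * ((p n + 1) / 2)" for n
    proof -
      have "0 \<le> (p n + 1) / 2" "(p n + 1) / 2 \<le> 1" using assms(2)[OF p, of n] by (auto simp: abs_le_iff)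
      then show ?thesis using binary_expansion[of "(p n + 1) / 2"] by metis
    qed
    then obtain b where b: "\<And>n k. b n k \<in> {0, 1::real}" "\<And>n. (\<Sum>k. b n k * (1/2) ^ k) = 2 * ((p n + 1) / 2)"
      by metis
    define c where "c j = b (fst (prod_decode j)) (snd (prod_decode j))" for j
    have "t c = p" by (rule ext) (simp add: t_def c_def b(2) add_divide_distrib)
    moreover have "c \<in> D" using b(1) by (simp add: D_def c_def)
    ultimately show "p \<in> t ` D'" using p by (auto simp: D'_def)
  qed (auto simp: D'_def)
  have "closed K" by (rule compact_imp_closed[OF assms(1)])
  then have "compact D'"
    unfolding D'_def by (metis cD ct closedin_compact continuous_closedin_preimage)
  moreover have "inj_on e D'"
    unfolding e_def D'_def D_def by (rule inj_on_subset[OF inj_on_ternary_series]) auto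
  moreover have "continuous_on D' e" unfolding D'_def by (rule continuous_on_subset[OF ce]) auto
  ultimately obtain h where h: "homeomorphism D' (e ` D') e h"
    using homeomorphism_compact by blast
  have "continuous_on D' t" unfolding D'_def by (rule continuous_on_subset[OF ct]) auto
  then have "continuous_on (e ` D') (t \<circ> h)"
    using h by (intro continuous_on_compose) (auto simp: homeomorphism_def)
  moreover have "(t \<circ> h) ` (e ` D') = K"
    using h surj by (metis homeomorphism_def image_comp)
  moreover have "compact (e ` D')"
    using \<open>compact D'\<close> \<open>continuous_on D' e\<close> by (rule compact_continuous_image[rotated])
  ultimately show ?thesis using that by blast
qed

section \<open>Choquet's theorem\<close>

text \<open>The least element of each fibre is chosen. Over the projection of \<open>R\<close> its
  sublevel sets are projections of compact sets, hence closed, and this gives Borel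
  measurability.\<close>

lemma compact_relation_selection:
  fixes R :: "('u::{t2_space, second_countable_topology} \<times> real) set"
  assumes "compact R"
  obtains f where "f \<in> borel_measurable borel" "\<And>u. u \<in> fst ` R \<Longrightarrow> (u, f u) \<in> R"
proof
  define f where "f = (\<lambda>u. if u \<in> fst ` R then Inf {c. (u, c) \<in> R} else 0)"
  have fib: "compact {c. (u, c) \<in> R}" for u
  proof -
    have "{c. (u, c) \<in> R} = snd ` (R \<inter> ({u} \<times> UNIV))" by force
    moreover have "compact (R \<inter> ({u} \<times> UNIV))"
      by (rule compact_Int_closed[OF assms]) (intro closed_Times closed_singleton closed_UNIV)
    ultimately show ?thesis
      by (auto intro!: compact_continuous_image continuous_on_snd continuous_on_id)
  qed
  show sel: "(u, f u) \<in> R" if "u \<in> fst ` R" for u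
  proof -
    have "{c. (u, c) \<in> R} \<noteq> {}" using that by auto
    then have "Inf {c. (u, c) \<in> R} \<in> {c. (u, c) \<in> R}"
      using fib[of u] by (intro closed_contains_Inf compact_imp_closed bounded_imp_bdd_below compact_imp_bounded)
    then show ?thesis using that by (simp add: f_def)
  qed
  have le: "f u \<le> c" if "(u, c) \<in> R" for u c
  proof -
    have "Inf {c. (u, c) \<in> R} \<le> c"
      using that fib[of u] by (intro cInf_lower bounded_imp_bdd_below compact_imp_bounded) auto
    moreover have "u \<in> fst ` R" using that by force
    ultimately show ?thesis by (simp add: f_def)
  qed
  have cl: "closed (fst ` (R \<inter> (UNIV \<times> {..a})))" for a
    by (intro compact_imp_closed compact_continuous_image continuous_on_fst
        continuous_on_id compact_Int_closed[OF assms] closed_Times closed_UNIV closed_atMost)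
  have cl2: "closed (fst ` R)"
    using assms by (intro compact_imp_closed compact_continuous_image continuous_on_fst continuous_on_id)
  show "f \<in> borel_measurable borel"
  proof (rule borel_measurableI_le)
    fix a
    \<comment> \<open>The default value off the projection is 0, so the complement belongs to the
      sublevel set exactly when 0 \<le> a.\<close>
    have "{u \<in> space borel. f u \<le> a} = fst ` (R \<inter> (UNIV \<times> {..a})) \<union> (if 0 \<le> a then - (fst ` R) else {})"
      (is "?A = ?B")
    proof (intro Set.set_eqI iffI)
      fix u assume "u \<in> ?A"
      then have fa: "f u \<le> a" by simp
      show "u \<in> ?B"
      proof (cases "u \<in> fst ` R")
        case True
        then have "(u, f u) \<in> R \<inter> (UNIV \<times> {..a})" using sel fa by auto
        then show ?thesis by force
      next
        case False
        then have "f u = 0" by (simp add: f_def)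
        with False fa show ?thesis by auto
      qed
    next
      fix u assume "u \<in> ?B"
      then consider "u \<in> fst ` (R \<inter> (UNIV \<times> {..a}))" | "0 \<le> a" "u \<notin> fst ` R"
        by (auto split: if_splits)
      then show "u \<in> ?A"
      proof cases
        case 1
        then obtain c where "(u, c) \<in> R" "c \<le> a" by auto
        then show ?thesis using le[of u c] by auto
      next
        case 2
        then show ?thesis by (auto simp: f_def)
      qed
    qed
    also have "\<dots> \<in> sets borel"
      using cl[of a] cl2 by (auto intro!: sets.Un borel_closed)
    finally show "{u \<in> space borel. f u \<le> a} \<in> sets borel" .
  qed
qed

text \<open>One selection is made from the projection that forgets the last coordinate, the other
  from \<open>R\<close> over the pairs (u, f u), so that the two choices are compatible.\<close>

lemma compact_relation_selection2:
  fixes R :: "(('u::{t2_space, second_countable_topology} \<times> real) \<times> real) set"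
  assumes "compact R"
  obtains f g where "f \<in> borel_measurable borel" "g \<in> borel_measurable borel"
    "\<And>u. u \<in> fst ` fst ` R \<Longrightarrow> ((u, f u), g u) \<in> R"
proof -
  have c1: "compact (fst ` R)"
    using assms by (intro compact_continuous_image continuous_on_fst continuous_on_id)
  obtain f where f: "f \<in> borel_measurable borel" "\<And>u. u \<in> fst ` fst ` R \<Longrightarrow> (u, f u) \<in> fst ` R"
    using compact_relation_selection[OF c1] by blast
  obtain h where h: "h \<in> borel_measurable borel" "\<And>u. u \<in> fst ` R \<Longrightarrow> (u, h u) \<in> R"
    using compact_relation_selection[OF assms] by blast
  have m: "(\<lambda>u. (u, f u)) \<in> borel_measurable borel"
    using f(1) by (intro borel_measurable_Pair) auto
  have "(\<lambda>u. h (u, f u)) \<in> borel_measurable borel"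
    using measurable_compose[OF m h(1)] .
  with that f h show ?thesis by blast
qed

text \<open>Weak convergence is tested on the truncated distance to \<open>C\<close>, a bounded
  continuous function whose zero set is \<open>C\<close>.\<close>

lemma weak_limit_closed_support:
  assumes "\<And>k. real_distribution (\<mu> k)" "real_distribution M" "weak_conv_m \<mu> M"
    and C: "closed C" and ae: "\<And>k. AE x in \<mu> k. x \<in> C"
  shows "AE x in M. x \<in> C"
\<comment> \<open>The distance to the empty set is 0 by convention, so the test function would say
  nothing; in this case the hypothesis already contradicts total mass 1.\<close>
proof (cases "C = {}")
  case True
  interpret real_distribution "\<mu> 0" by fact
  from ae[of 0] True have "AE x in \<mu> 0. False" by simp
  then have "emeasure (\<mu> 0) (space (\<mu> 0)) = 0" by (simp add: AE_False)
  then show ?thesis using emeasure_space_1 by simp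
next
  case False
  interpret M: real_distribution M by fact
  define f where "f x = min 1 (infdist x C)" for x :: real
  have cf: "isCont f x" for x
    unfolding f_def by (intro continuous_intros)
  have bf: "norm (f x) \<le> 1" for x by (simp add: f_def infdist_nonneg)
  have "(\<lambda>n. integral\<^sup>L (\<mu> n) f) \<longlonglongrightarrow> integral\<^sup>L M f"
    by (rule weak_conv_imp_integral_bdd_continuous_conv[OF assms(1-3) cf bf])
  moreover have "integral\<^sup>L (\<mu> n) f = 0" for n
  proof (rule integral_eq_zero_AE)
    show "AE x in \<mu> n. f x = 0" using ae[of n] by eventually_elim (simp add: f_def)
  qed
  ultimately have z: "integral\<^sup>L M f = 0" by (simp add: LIMSEQ_const_iff)
  have fm: "f \<in> borel_measurable borel"
    using cf by (intro borel_measurable_continuous_onI) (simp add: continuous_at_imp_continuous_on)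
  have "integrable M f"
    by (rule M.integrable_const_bound[of _ 1]) (use bf fm M.M_is_borel in \<open>auto simp: measurable_def\<close>)
  then have "AE x in M. f x = 0"
    using z by (subst (asm) integral_nonneg_eq_0_iff_AE) (auto simp: f_def infdist_nonneg)
  then show ?thesis
  proof eventually_elim
    case (elim x)
    then have "infdist x C = 0" by (simp add: f_def min_def split: if_splits)
    then show ?case using C False by (simp add: in_closed_iff_infdist_zero)
  qed
qed

text \<open>An independent fair coin decides between \<open>f\<close> and \<open>g\<close>;
  \<open>\<nu>'\<close> is the law of the outcome, that is, the average of the two image
  measures.\<close>

lemma real_distribution_mixture:
  assumes "real_distribution \<nu>" "f \<in> borel_measurable borel" "g \<in> borel_measurable borel"
  obtains \<nu>' where "real_distribution \<nu>'"
    "\<And>P. Measurable.pred borel P \<Longrightarrow> AE x in \<nu>. P (f x) \<and> P (g x) \<Longrightarrow> AE x in \<nu>'. P x"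
    "\<And>h :: real \<Rightarrow> real. h \<in> borel_measurable borel \<Longrightarrow> (\<And>x. \<bar>h x\<bar> \<le> B) \<Longrightarrow>
       integral\<^sup>L \<nu>' h = (integral\<^sup>L \<nu> (\<lambda>x. h (f x)) + integral\<^sup>L \<nu> (\<lambda>x. h (g x))) / 2"
proof -
  interpret \<nu>: real_distribution \<nu> by fact
  let ?c = "measure_pmf (bernoulli_pmf (1/2))"
  let ?P = "?c \<Otimes>\<^sub>M \<nu>"
  define s where "s = (\<lambda>(b, x). if b then f x else g x)"
  interpret c: prob_space ?c by (rule prob_space_measure_pmf)
  interpret P: pair_prob_space ?c \<nu> ..
  have [measurable]: "f \<in> borel_measurable \<nu>" "g \<in> borel_measurable \<nu>"
    using assms \<nu>.M_is_borel by (auto simp: measurable_def)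
  have s: "s \<in> borel_measurable ?P" unfolding s_def by measurable
  define \<nu>' where "\<nu>' = distr ?P borel s"
  have 1: "real_distribution \<nu>'"
    unfolding \<nu>'_def real_distribution_def real_distribution_axioms_def
    using P.prob_space_distr[OF s] by simp
  have 2: "AE x in \<nu>'. P x" if m[measurable]: "Measurable.pred borel P" and ae: "AE x in \<nu>. P (f x) \<and> P (g x)" for P
  proof -
    have "AE z in ?P. P (s z)"
    proof -
      have ms: "{z \<in> space ?P. P (s z)} \<in> sets ?P"
        using measurable_compose[OF s m] by (simp add: pred_def)
      have "AE b in ?c. AE x in \<nu>. P (s (b, x))"
        using ae by (auto simp: s_def AE_measure_pmf_iff elim: eventually_mono)
      then show ?thesis
        using P.AE_pair_measure[OF ms] by simp
    qed
    then show ?thesis unfolding \<nu>'_def using s m by (subst AE_distr_iff) (auto simp: pred_def)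
  qed
  have 3: "integral\<^sup>L \<nu>' h = (integral\<^sup>L \<nu> (\<lambda>x. h (f x)) + integral\<^sup>L \<nu> (\<lambda>x. h (g x))) / 2"
    if h: "h \<in> borel_measurable borel" and b: "\<And>x. \<bar>h x\<bar> \<le> B" for h :: "real \<Rightarrow> real"
  proof -
    have "integral\<^sup>L \<nu>' h = integral\<^sup>L ?P (\<lambda>z. h (s z))"
      unfolding \<nu>'_def by (rule integral_distr[OF s h])
    also have "\<dots> = (\<integral>b. (\<integral>x. h (s (b, x)) \<partial>\<nu>) \<partial>?c)"
    proof (rule P.integral_fst'[symmetric])
      show "integrable ?P (\<lambda>z. h (s z))"
        using b measurable_compose[OF s h] by (intro P.integrable_const_bound[of _ B]) auto
    qed
    also have "\<dots> = (integral\<^sup>L \<nu> (\<lambda>x. h (f x)) + integral\<^sup>L \<nu> (\<lambda>x. h (g x))) / 2"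
      by (subst integral_bernoulli_pmf) (auto simp: s_def)
    finally show ?thesis .
  qed
  from that[OF 1 2 3] show ?thesis by blast
qed

text \<open>A distribution on \<open>C\<close> with the given barycenter that maximises the integral of the strictly convex
  function \<open>\<Sum>n. (a n)\<^sup>2 / 2 ^ n\<close> exists by Helly's theorem. If it charged a set of points that are
  midpoints of distinct points, then replacing these points by a measurable choice of endpoints would
  increase the integral.\<close>
lemma choquet_on_real:
  fixes a :: "nat \<Rightarrow> real \<Rightarrow> real"
  assumes C: "compact C" and x0: "x0 \<in> C"
    and cont: "\<And>n. continuous_on UNIV (a n)" and bdd: "\<And>n x. \<bar>a n x\<bar> \<le> 1"
  obtains \<nu> where "real_distribution \<nu>" "AE x in \<nu>. x \<in> C"
    "\<forall>n. integral\<^sup>L \<nu> (a n) = a n x0"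
    "AE x in \<nu>. \<forall>c\<in>C. \<forall>d\<in>C. (\<forall>n. a n c + a n d = 2 * a n x) \<longrightarrow> (\<forall>n. a n c = a n d)"
proof -
  define F where "F x = (\<Sum>n. (1/2)^n * (a n x)\<^sup>2)" for x
  have a2: "(a n x)\<^sup>2 \<le> 1" for n x
    using bdd[of n x] by (simp add: abs_square_le_1)
  have tb: "norm ((1/2)^n * (a n x)\<^sup>2) \<le> (1/2)^n" for n x
    using a2[of n x] by (simp add: abs_mult mult_le_cancel_left1)
  have sg: "summable (\<lambda>n. (1/2::real)^n)" by (rule summable_geometric) simp
  have sF: "summable (\<lambda>n. (1/2)^n * (a n x)\<^sup>2)" for x
    by (rule summable_comparison_test'[OF sg]) (use tb in auto)
  have contF: "continuous_on UNIV F"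
  proof -
    have "uniform_limit UNIV (\<lambda>n x. \<Sum>i<n. (1/2)^i * (a i x)\<^sup>2) F sequentially"
      unfolding F_def by (rule Weierstrass_m_test[OF tb sg])
    then show ?thesis
      by (rule uniform_limit_theorem[rotated])
        (auto intro!: always_eventually continuous_intros cont)
  qed
  have F0: "0 \<le> F x" for x unfolding F_def by (intro suminf_nonneg sF) auto
  have F2: "F x \<le> 2" for x
  proof -
    have "F x \<le> (\<Sum>n. (1/2)^n)" unfolding F_def
      using tb[of _ x] by (intro suminf_le sF sg) (auto simp: abs_le_iff)
    then show ?thesis by (simp add: suminf_geometric)
  qed
  have Fb: "\<bar>F x\<bar> \<le> 2" for x using F0[of x] F2[of x] by simp
  have am[measurable]: "a n \<in> borel_measurable borel" for n
    using cont by (rule borel_measurable_continuous_onI)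
  have Fm[measurable]: "F \<in> borel_measurable borel"
    using contF by (rule borel_measurable_continuous_onI)
  have int: "integrable \<nu> h" if "real_distribution \<nu>" "h \<in> borel_measurable borel" "\<And>x. \<bar>h x\<bar> \<le> B" for h :: "real \<Rightarrow> real" and B \<nu>
  proof -
    interpret real_distribution \<nu> by fact
    show ?thesis using that by (intro integrable_const_bound[of _ B]) auto
  qed
  define \<P> where "\<P> = {\<nu>. real_distribution \<nu> \<and> (AE x in \<nu>. x \<in> C) \<and> (\<forall>n. integral\<^sup>L \<nu> (a n) = a n x0)}"
  \<comment> \<open>The point mass at \<open>x0\<close> shows that the supremum below runs over a
    nonempty set.\<close>
  have dirac: "return borel x0 \<in> \<P>"
  proof -
    have "real_distribution (return borel x0)"
      unfolding real_distribution_def real_distribution_axioms_def by (simp add: prob_space_return)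
    moreover have "AE x in return borel x0. x \<in> C"
      using x0 C by (subst AE_return) (auto intro: borel_closed compact_imp_closed simp: pred_def)
    ultimately show ?thesis by (simp add: \<P>_def integral_return)
  qed
  define L where "L = (SUP \<nu>\<in>\<P>. integral\<^sup>L \<nu> F)"
  have ub: "integral\<^sup>L \<nu> F \<le> 2" if "\<nu> \<in> \<P>" for \<nu>
  proof -
    interpret real_distribution \<nu> using that by (simp add: \<P>_def)
    show ?thesis
      using F2 Fb int[of \<nu> F 2] that by (intro integral_le_const) (auto simp: \<P>_def)
  qed
  have bddA: "bdd_above ((\<lambda>\<nu>. integral\<^sup>L \<nu> F) ` \<P>)" using ub by (auto intro!: bdd_aboveI)
  have "\<exists>\<nu>\<in>\<P>. integral\<^sup>L \<nu> F > L - 1 / real (Suc k)" for k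
    unfolding L_def using dirac bddA less_cSUP_iff[of \<P> "\<lambda>\<nu>. integral\<^sup>L \<nu> F" "L - 1 / real (Suc k)"] 
    by (auto simp: L_def)
  then obtain \<mu> where \<mu>: "\<And>k. \<mu> k \<in> \<P>" "\<And>k. integral\<^sup>L (\<mu> k) F > L - 1 / real (Suc k)" by metis
  have rd: "real_distribution (\<mu> k)" for k using \<mu>(1) by (simp add: \<P>_def)
  obtain b where b: "b > 0" "\<And>x. x \<in> C \<Longrightarrow> \<bar>x\<bar> < b"
    using compact_imp_bounded[OF C] by (metis bounded_pos_less real_norm_def)
  have "tight \<mu>"
    unfolding tight_def
  proof (intro conjI allI impI rd)
    fix \<epsilon> :: real assume "\<epsilon> > 0"
    show "\<exists>a b. a < b \<and> (\<forall>n. 1 - \<epsilon> < measure (\<mu> n) {a<..b})"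
    proof (intro exI conjI allI)
      show "- b < b" using b by simp
      fix n
      interpret real_distribution "\<mu> n" by (rule rd)
      have "AE x in \<mu> n. x \<in> C" using \<mu>(1) by (simp add: \<P>_def)
      then have "AE x in \<mu> n. x \<in> {-b<..b}"
        by eventually_elim (use b in \<open>force simp: abs_less_iff\<close>)
      then have "prob {-b<..b} = 1" by (subst prob_eq_1) auto
      then show "1 - \<epsilon> < measure (\<mu> n) {-b<..b}" using \<open>\<epsilon> > 0\<close> by simp
    qed
  qed
  from tight_imp_convergent_subsubsequence[OF this strict_mono_id]
  obtain r \<nu> where r: "strict_mono r" and \<nu>: "real_distribution \<nu>" and w: "weak_conv_m (\<mu> \<circ> r) \<nu>"
    by (auto simp: comp_assoc)
  have rd': "\<And>k. real_distribution ((\<mu> \<circ> r) k)" using rd by simp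
  have lim: "(\<lambda>n. integral\<^sup>L (\<mu> (r n)) h) \<longlonglongrightarrow> integral\<^sup>L \<nu> h"
    if "continuous_on UNIV h" "\<And>x. \<bar>h x\<bar> \<le> B" for h :: "real \<Rightarrow> real" and B
    using weak_conv_imp_integral_bdd_continuous_conv[OF rd' \<nu> w, of h B] that
    by (simp add: continuous_on_eq_continuous_at)
  have aeC: "AE x in \<nu>. x \<in> C"
  proof (rule weak_limit_closed_support[OF rd' \<nu> w compact_imp_closed[OF C]])
    show "AE x in (\<mu> \<circ> r) k. x \<in> C" for k
      using \<mu>(1)[of "r k"] unfolding \<P>_def comp_def by blast
  qed
  have bary: "integral\<^sup>L \<nu> (a n) = a n x0" for n
  proof -
    have "(\<lambda>k. integral\<^sup>L (\<mu> (r k)) (a n)) \<longlonglongrightarrow> integral\<^sup>L \<nu> (a n)"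
      by (rule lim[OF cont bdd])
    moreover have "integral\<^sup>L (\<mu> (r k)) (a n) = a n x0" for k using \<mu>(1) by (simp add: \<P>_def)
    ultimately show ?thesis by (simp add: LIMSEQ_const_iff)
  qed
  have max: "L \<le> integral\<^sup>L \<nu> F"
  proof -
    have "(\<lambda>k. integral\<^sup>L (\<mu> (r k)) F) \<longlonglongrightarrow> integral\<^sup>L \<nu> F"
      by (rule lim[OF contF Fb])
    moreover have "(\<lambda>k. L - 1 / real (Suc (r k))) \<longlonglongrightarrow> L"
    proof -
      have "(\<lambda>k. L - 1 / real (Suc k)) \<longlonglongrightarrow> L - 0"
        by (intro tendsto_diff tendsto_const) (use LIMSEQ_inverse_real_of_nat in \<open>simp add: inverse_eq_divide\<close>)
      from LIMSEQ_subseq_LIMSEQ[OF this r] show ?thesis by (simp add: comp_def)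
    qed
    ultimately show ?thesis
      using \<mu>(2) by (intro LIMSEQ_le[of "\<lambda>k. L - 1 / real (Suc (r k))" L]) (auto intro: less_imp_le)
  qed
  interpret \<nu>: real_distribution \<nu> by (rule \<nu>)
  \<comment> \<open>Distinctness of the endpoints is split into countably many closed conditions: a
    gap of at least 1 / (k + 1) in coordinate m. Each of them makes the relation \<open>R\<close>
    between midpoints and endpoints compact, so that endpoints can be chosen measurably.\<close>
  have null: "AE x in \<nu>. \<not> (\<exists>c\<in>C. \<exists>d\<in>C. (\<forall>n. a n c + a n d = 2 * a n x) \<and> 1 / real (Suc k) \<le> \<bar>a m c - a m d\<bar>)" for m k
  proof -
    define R where "R = {((x, c), d). x \<in> C \<and> c \<in> C \<and> d \<in> C \<and> (\<forall>n. a n c + a n d = 2 * a n x) \<and> 1 / real (Suc k) \<le> \<bar>a m c - a m d\<bar>}"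
    have "R = ((C \<times> C) \<times> C) \<inter> ((\<Inter>n. {z. a n (snd (fst z)) + a n (snd z) = 2 * a n (fst (fst z))}) \<inter>
       {z. 1 / real (Suc k) \<le> \<bar>a m (snd (fst z)) - a m (snd z)\<bar>})"
      by (auto simp: R_def)
    moreover have "closed ((\<Inter>n. {z. a n (snd (fst z)) + a n (snd z) = 2 * a n (fst (fst z))}) \<inter>
       {z. 1 / real (Suc k) \<le> \<bar>a m (snd (fst z)) - a m (snd z)\<bar>})"
      by (intro closed_Int closed_INT ballI closed_Collect_eq closed_Collect_le continuous_intros
          continuous_on_compose2[OF cont]) auto
    ultimately have cR: "compact R" using C by (auto intro!: compact_Int_closed compact_Times)
    obtain f g where f[measurable]: "f \<in> borel_measurable borel" and g[measurable]: "g \<in> borel_measurable borel"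
      and fg: "\<And>u. u \<in> fst ` fst ` R \<Longrightarrow> ((u, f u), g u) \<in> R"
      using compact_relation_selection2[OF cR] by blast
    define V where "V = fst ` fst ` R"
    have "closed V" unfolding V_def
      using cR by (intro compact_imp_closed compact_continuous_image continuous_on_fst continuous_on_id)
    then have Vm[measurable]: "V \<in> sets borel" by simp
    \<comment> \<open>Points outside \<open>V\<close> stay where they are, so the midpoint identity
      holds everywhere and the barycenter is preserved.\<close>
    define f' where "f' x = (if x \<in> V then f x else x)" for x
    define g' where "g' x = (if x \<in> V then g x else x)" for x
    have f'[measurable]: "f' \<in> borel_measurable borel" unfolding f'_def by measurable
    have g'[measurable]: "g' \<in> borel_measurable borel" unfolding g'_def by measurable
    have sum: "a n (f' x) + a n (g' x) = 2 * a n x" for n x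
      using fg[of x] by (auto simp: f'_def g'_def V_def R_def)
    have fgC: "f' x \<in> C \<and> g' x \<in> C" if "x \<in> C" for x
      using fg[of x] that by (auto simp: f'_def g'_def V_def R_def)
    obtain \<nu>' where \<nu>': "real_distribution \<nu>'"
      "\<And>P. Measurable.pred borel P \<Longrightarrow> AE x in \<nu>. P (f' x) \<and> P (g' x) \<Longrightarrow> AE x in \<nu>'. P x"
      "\<And>h :: real \<Rightarrow> real. h \<in> borel_measurable borel \<Longrightarrow> (\<And>x. \<bar>h x\<bar> \<le> 2) \<Longrightarrow>
       integral\<^sup>L \<nu>' h = (integral\<^sup>L \<nu> (\<lambda>x. h (f' x)) + integral\<^sup>L \<nu> (\<lambda>x. h (g' x))) / 2"
      using real_distribution_mixture[OF \<nu> f' g', of 2] by blast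
    have "\<nu>' \<in> \<P>"
      unfolding \<P>_def
    proof (intro CollectI conjI allI)
      show "AE x in \<nu>'. x \<in> C"
      proof (rule \<nu>'(2))
        show "Measurable.pred borel (\<lambda>x. x \<in> C)"
          using C by (simp add: pred_def borel_closed compact_imp_closed)
        show "AE x in \<nu>. f' x \<in> C \<and> g' x \<in> C"
          using aeC by eventually_elim (rule fgC)
      qed
      fix n
      have "integral\<^sup>L \<nu>' (a n) = (integral\<^sup>L \<nu> (\<lambda>x. a n (f' x)) + integral\<^sup>L \<nu> (\<lambda>x. a n (g' x))) / 2"
        by (intro \<nu>'(3) am order.trans[OF bdd]) simp
      also have "\<dots> = integral\<^sup>L \<nu> (\<lambda>x. a n (f' x) + a n (g' x)) / 2"
        using bdd[of n] by (subst Bochner_Integration.integral_add) (auto intro!: int[OF \<nu>, of _ 1])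
      also have "\<dots> = a n x0" using bary by (simp add: sum)
      finally show "integral\<^sup>L \<nu>' (a n) = a n x0" .
    qed (fact \<nu>'(1))
    then have "integral\<^sup>L \<nu>' F \<le> L" unfolding L_def using bddA by (intro cSUP_upper)
    then have le: "integral\<^sup>L \<nu>' F \<le> integral\<^sup>L \<nu> F" using max by simp
    \<comment> \<open>From (b^2 + c^2) / 2 - ((b + c) / 2)^2 = (b - c)^2 / 4, taken in coordinate m
      with weight (1/2)^m and gap 1 / (k + 1).\<close>
    define \<delta> where "\<delta> = (1/2)^m * (1 / real (Suc k))\<^sup>2 / 4"
    have \<delta>: "\<delta> > 0" by (simp add: \<delta>_def)
    have gain: "F x + \<delta> * indicator V x \<le> (F (f' x) + F (g' x)) / 2" for x
    proof -
      have "(F (f' x) + F (g' x)) / 2 - F x =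
        (\<Sum>n. ((1/2)^n * (a n (f' x))\<^sup>2 + (1/2)^n * (a n (g' x))\<^sup>2) / 2 - (1/2)^n * (a n x)\<^sup>2)"
      proof (rule sums_unique)
        have h: "(\<lambda>n. (1/2)^n * (a n y)\<^sup>2) sums F y" for y
          unfolding F_def by (rule summable_sums[OF sF])
        show "(\<lambda>n. ((1/2)^n * (a n (f' x))\<^sup>2 + (1/2)^n * (a n (g' x))\<^sup>2) / 2 - (1/2)^n * (a n x)\<^sup>2) sums
          ((F (f' x) + F (g' x)) / 2 - F x)"
          by (intro sums_diff sums_divide sums_add h)
      qed
      also have "\<dots> = (\<Sum>n. (1/2)^n * (a n (f' x) - a n (g' x))\<^sup>2 / 4)"
      proof (rule suminf_cong)
        fix n
        have e: "a n x = (a n (f' x) + a n (g' x)) / 2" using sum[of n x] by simp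
        show "((1/2)^n * (a n (f' x))\<^sup>2 + (1/2)^n * (a n (g' x))\<^sup>2) / 2 - (1/2)^n * (a n x)\<^sup>2 =
          (1/2)^n * (a n (f' x) - a n (g' x))\<^sup>2 / 4"
          unfolding e by (simp add: field_simps power2_eq_square)
      qed
      also have "\<dots> \<ge> \<delta> * indicator V x"
      proof -
        have s: "summable (\<lambda>n. (1/2)^n * (a n (f' x) - a n (g' x))\<^sup>2 / 4)"
        proof (rule summable_comparison_test'[OF sg])
          fix n :: nat
          have "\<bar>a n (f' x) - a n (g' x)\<bar> \<le> 2" using bdd[of n "f' x"] bdd[of n "g' x"] by simp
          then have "(a n (f' x) - a n (g' x))\<^sup>2 \<le> 4" using abs_le_square_iff[of "a n (f' x) - a n (g' x)" 2] by simp
          then show "norm ((1/2)^n * (a n (f' x) - a n (g' x))\<^sup>2 / 4) \<le> (1/2)^n" by (simp add: abs_mult)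
        qed
        have "\<delta> * indicator V x \<le> (1/2)^m * (a m (f' x) - a m (g' x))\<^sup>2 / 4"
        proof (cases "x \<in> V")
          case True
          then have "1 / real (Suc k) \<le> \<bar>a m (f' x) - a m (g' x)\<bar>"
            using fg[of x] by (auto simp: V_def R_def f'_def g'_def)
          then have "(1 / real (Suc k))\<^sup>2 \<le> (a m (f' x) - a m (g' x))\<^sup>2"
            by (metis abs_le_square_iff abs_of_nonneg divide_nonneg_nonneg of_nat_0_le_iff zero_le_one)
          then have "(1/2)^m * (1 / real (Suc k))\<^sup>2 / 4 \<le> (1/2)^m * (a m (f' x) - a m (g' x))\<^sup>2 / 4"
            by (intro divide_right_mono mult_left_mono) auto
          then show ?thesis using True by (simp add: \<delta>_def)
        qed simp
        also have "\<dots> = (\<Sum>n\<in>{m}. (1/2)^n * (a n (f' x) - a n (g' x))\<^sup>2 / 4)" by simp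
        also have "\<dots> \<le> (\<Sum>n. (1/2)^n * (a n (f' x) - a n (g' x))\<^sup>2 / 4)"
          by (rule sum_le_suminf[OF s]) auto
        finally show ?thesis .
      qed
      finally show ?thesis by linarith
    qed
    have iF: "integrable \<nu> F" using Fb by (intro int[OF \<nu> Fm])
    have iV: "integrable \<nu> (\<lambda>x. \<delta> * indicator V x)"
      using \<delta> by (intro int[OF \<nu>, of _ \<delta>]) (auto simp: indicator_def)
    have "integral\<^sup>L \<nu> F + \<delta> * \<nu>.prob V = integral\<^sup>L \<nu> (\<lambda>x. F x + \<delta> * indicator V x)"
      using Fb by (subst Bochner_Integration.integral_add[OF iF iV]) simp
    also have "\<dots> \<le> integral\<^sup>L \<nu> (\<lambda>x. (F (f' x) + F (g' x)) / 2)"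
    proof (rule integral_mono)
      show "integrable \<nu> (\<lambda>x. F x + \<delta> * indicator V x)"
        by (intro Bochner_Integration.integrable_add iF iV)
      show "integrable \<nu> (\<lambda>x. (F (f' x) + F (g' x)) / 2)"
        using Fb by (intro integrable_divide Bochner_Integration.integrable_add int[OF \<nu>, of _ 2]) auto
    qed (rule gain)
    also have "\<dots> = integral\<^sup>L \<nu>' F"
      using Fb by (subst \<nu>'(3)) (auto intro!: Bochner_Integration.integral_add int[OF \<nu>, of _ 2])
    also note le
    finally have "\<nu>.prob V \<le> 0" using \<delta> by (simp add: mult_le_0_iff)
    then have "\<nu>.prob V = 0" using measure_nonneg[of \<nu> V] by linarith
    then have "AE x in \<nu>. x \<notin> V" by (subst (asm) \<nu>.prob_eq_0) auto
    with aeC show ?thesis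
    proof eventually_elim
      case (elim x)
      show ?case
      proof
        assume "\<exists>c\<in>C. \<exists>d\<in>C. (\<forall>n. a n c + a n d = 2 * a n x) \<and> 1 / real (Suc k) \<le> \<bar>a m c - a m d\<bar>"
        then obtain c d where "((x, c), d) \<in> R" using elim by (auto simp: R_def)
        then have "x \<in> V" by (force simp: V_def)
        with elim show False by simp
      qed
    qed
  qed
  have "AE x in \<nu>. \<forall>m k. \<not> (\<exists>c\<in>C. \<exists>d\<in>C. (\<forall>n. a n c + a n d = 2 * a n x) \<and> 1 / real (Suc k) \<le> \<bar>a m c - a m d\<bar>)"
    using null by (simp add: AE_all_countable)
  then have "AE x in \<nu>. \<forall>c\<in>C. \<forall>d\<in>C. (\<forall>n. a n c + a n d = 2 * a n x) \<longrightarrow> (\<forall>n. a n c = a n d)"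
  proof eventually_elim
    case (elim x)
    show ?case
    proof (intro ballI impI allI, rule ccontr)
      fix c d n
      assume cd: "c \<in> C" "d \<in> C" "\<forall>n. a n c + a n d = 2 * a n x" "a n c \<noteq> a n d"
      then have "\<bar>a n c - a n d\<bar> > 0" by simp
      then obtain k where "1 / real (Suc k) < \<bar>a n c - a n d\<bar>" by (rule nat_approx_posE)
      with cd elim show False by (meson less_imp_le)
    qed
  qed
  with that \<nu> aeC bary show ?thesis by blast
qed


text \<open>Tietze's theorem extends the coordinates from \<open>C\<close> to the line with the same
  bound 1. On the line extremality concerns coordinates and not points of \<open>C\<close>, since
  the parametrisation need not be injective; equality of all coordinates then means q = r in
  \<open>K\<close>.\<close>

theorem choquet_sequences:
  fixes K :: "(nat \<Rightarrow> real) set"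
  assumes K: "compact K" "\<And>p n. p \<in> K \<Longrightarrow> \<bar>p n\<bar> \<le> 1" and p: "p \<in> K"
  obtains \<nu> :: "real measure" and s :: "real \<Rightarrow> nat \<Rightarrow> real"
  where "prob_space \<nu>" "\<And>n. (\<lambda>x. s x n) \<in> borel_measurable \<nu>" "\<And>n x. \<bar>s x n\<bar> \<le> 1"
    "\<And>n. (\<integral>x. s x n \<partial>\<nu>) = p n"
    "AE x in \<nu>. s x \<in> K \<and> (\<forall>q\<in>K. \<forall>r\<in>K. (\<forall>n. q n + r n = 2 * s x n) \<longrightarrow> q = r)"
proof -
  obtain C and t :: "real \<Rightarrow> nat \<Rightarrow> real" where C: "compact C" and t: "continuous_on C t" "t ` C = K"
    using compact_sequences_image_of_compact_real[OF K(1)] K(2) by blast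
  have "\<exists>a. continuous_on UNIV a \<and> (\<forall>x\<in>C. a x = t x n) \<and> (\<forall>x. \<bar>a x\<bar> \<le> 1)" for n
  proof -
    have "continuous_on C (\<lambda>x. t x n)" using t(1) by (rule continuous_on_product_then_coordinatewise)
    moreover have "closedin (top_of_set UNIV) C" using C by (simp add: compact_imp_closed)
    moreover have "norm (t x n) \<le> 1" if "x \<in> C" for x using K(2) t(2) that by auto
    ultimately show ?thesis
      using Tietze[of C "\<lambda>x. t x n" UNIV 1] by (metis UNIV_I real_norm_def zero_le_one)
  qed
  then obtain a where a: "\<And>n. continuous_on UNIV (a n)" "\<And>n x. x \<in> C \<Longrightarrow> a n x = t x n"
    "\<And>n x. \<bar>a n x\<bar> \<le> 1" by metis
  obtain x0 where x0: "x0 \<in> C" "p = t x0" using p t(2) by auto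
  obtain \<nu> where \<nu>: "real_distribution \<nu>" "AE x in \<nu>. x \<in> C"
    "\<forall>n. integral\<^sup>L \<nu> (a n) = a n x0"
    "AE x in \<nu>. \<forall>c\<in>C. \<forall>d\<in>C. (\<forall>n. a n c + a n d = 2 * a n x) \<longrightarrow> (\<forall>n. a n c = a n d)"
    by (rule choquet_on_real[of C x0 a, OF C x0(1) a(1) a(3)])
  interpret \<nu>: real_distribution \<nu> by fact
  have ext: "AE x in \<nu>. (\<lambda>n. a n x) \<in> K \<and>
      (\<forall>q\<in>K. \<forall>r\<in>K. (\<forall>n. q n + r n = 2 * a n x) \<longrightarrow> q = r)"
    using \<nu>(2,4)
  proof eventually_elim
    case (elim x)
    have "(\<lambda>n. a n x) = t x" by (rule ext) (rule a(2)[OF elim(1)])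
    then have 1: "(\<lambda>n. a n x) \<in> K" using t(2) elim(1) by auto
    have 2: "q = r" if qr: "q \<in> K" "r \<in> K" "\<forall>n. q n + r n = 2 * a n x" for q r
    proof -
      obtain c d where cd: "c \<in> C" "d \<in> C" "q = t c" "r = t d" using qr t(2) by auto
      have ac: "a n c = q n" and ad: "a n d = r n" for n using cd a(2) by auto
      have "\<forall>n. a n c + a n d = 2 * a n x" using qr(3) by (simp add: ac ad)
      then have "\<forall>n. a n c = a n d" using elim(2) cd(1,2) by blast
      then show ?thesis by (auto simp: ac ad)
    qed
    show ?case using 1 2 by blast
  qed
  show ?thesis
  proof (rule that[of \<nu> "\<lambda>x n. a n x"])
    show "prob_space \<nu>" by (rule \<nu>.prob_space_axioms)
    show "(\<lambda>x. a n x) \<in> borel_measurable \<nu>" for n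
      using borel_measurable_continuous_onI[OF a(1)[of n]] by simp
    show "(\<integral>x. a n x \<partial>\<nu>) = p n" for n using \<nu>(3) a(2)[OF x0(1)] x0(2) by simp
  qed (use a(3) ext in auto)
qed

section \<open>Decomposition of traces into characters\<close>

lemma positive_definiteD:
  fixes n :: nat and c :: "nat \<Rightarrow> complex"
  assumes "positive_definite G \<phi>" "\<And>i. i < n \<Longrightarrow> g i \<in> carrier G"
  shows "Im (\<Sum>i<n. \<Sum>j<n. cnj (c i) * c j * \<phi> (inv\<^bsub>G\<^esub> (g i) \<otimes>\<^bsub>G\<^esub> g j)) = 0"
    "0 \<le> Re (\<Sum>i<n. \<Sum>j<n. cnj (c i) * c j * \<phi> (inv\<^bsub>G\<^esub> (g i) \<otimes>\<^bsub>G\<^esub> g j))"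
proof -
  have "\<forall>i<n. g i \<in> carrier G" using assms(2) by blast
  then have *: "Im (\<Sum>i<n. \<Sum>j<n. cnj (c i) * c j * \<phi> (inv\<^bsub>G\<^esub> (g i) \<otimes>\<^bsub>G\<^esub> g j)) = 0 \<and>
    0 \<le> Re (\<Sum>i<n. \<Sum>j<n. cnj (c i) * c j * \<phi> (inv\<^bsub>G\<^esub> (g i) \<otimes>\<^bsub>G\<^esub> g j))"
    using assms(1)[unfolded positive_definite_def Let_def, rule_format, of n g c] by simp
  then show "Im (\<Sum>i<n. \<Sum>j<n. cnj (c i) * c j * \<phi> (inv\<^bsub>G\<^esub> (g i) \<otimes>\<^bsub>G\<^esub> g j)) = 0" ..
  show "0 \<le> Re (\<Sum>i<n. \<Sum>j<n. cnj (c i) * c j * \<phi> (inv\<^bsub>G\<^esub> (g i) \<otimes>\<^bsub>G\<^esub> g j))" using * ..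
qed

lemma positive_definiteI:
  assumes "\<And>n (c :: nat \<Rightarrow> complex) g. (\<And>i. i < n \<Longrightarrow> g i \<in> carrier G) \<Longrightarrow>
    Im (\<Sum>i<n. \<Sum>j<n. cnj (c i) * c j * \<phi> (inv\<^bsub>G\<^esub> (g i) \<otimes>\<^bsub>G\<^esub> g j)) = 0 \<and>
    0 \<le> Re (\<Sum>i<n. \<Sum>j<n. cnj (c i) * c j * \<phi> (inv\<^bsub>G\<^esub> (g i) \<otimes>\<^bsub>G\<^esub> g j))"
  shows "positive_definite G \<phi>"
  using assms unfolding positive_definite_def Let_def by blast

lemma positive_definite_cong:
  assumes "group G" "\<And>g. g \<in> carrier G \<Longrightarrow> \<phi> g = \<psi> g" "positive_definite G \<phi>"
  shows "positive_definite G \<psi>"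
proof (rule positive_definiteI)
  interpret group G by fact
  fix n :: nat and c :: "nat \<Rightarrow> complex" and g :: "nat \<Rightarrow> 'a"
  assume g: "\<And>i. i < n \<Longrightarrow> g i \<in> carrier G"
  have "(\<Sum>i<n. \<Sum>j<n. cnj (c i) * c j * \<psi> (inv\<^bsub>G\<^esub> (g i) \<otimes>\<^bsub>G\<^esub> g j)) =
    (\<Sum>i<n. \<Sum>j<n. cnj (c i) * c j * \<phi> (inv\<^bsub>G\<^esub> (g i) \<otimes>\<^bsub>G\<^esub> g j))"
    using g assms(2) by (intro sum.cong refl) auto
  then show "Im (\<Sum>i<n. \<Sum>j<n. cnj (c i) * c j * \<psi> (inv\<^bsub>G\<^esub> (g i) \<otimes>\<^bsub>G\<^esub> g j)) = 0 \<and>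
    0 \<le> Re (\<Sum>i<n. \<Sum>j<n. cnj (c i) * c j * \<psi> (inv\<^bsub>G\<^esub> (g i) \<otimes>\<^bsub>G\<^esub> g j))"
    using positive_definiteD[OF assms(3), of n g c] g by simp
qed

lemma is_trace_cong:
  assumes "group G" "\<And>g. g \<in> carrier G \<Longrightarrow> \<phi> g = \<psi> g" "is_trace G \<phi>"
  shows "is_trace G \<psi>"
proof -
  interpret group G by fact
  have "conj_invariant G \<psi>"
    unfolding conj_invariant_def
  proof (intro ballI)
    fix g h assume "g \<in> carrier G" "h \<in> carrier G"
    moreover have "\<phi> (h \<otimes>\<^bsub>G\<^esub> g \<otimes>\<^bsub>G\<^esub> inv\<^bsub>G\<^esub> h) = \<phi> g"
      using assms(3) calculation by (simp add: is_trace_def conj_invariant_def)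
    ultimately show "\<psi> (h \<otimes>\<^bsub>G\<^esub> g \<otimes>\<^bsub>G\<^esub> inv\<^bsub>G\<^esub> h) = \<psi> g"
      using assms(2) by simp
  qed
  moreover have "positive_definite G \<psi>"
    using positive_definite_cong[OF assms(1,2)] assms(3) by (simp add: is_trace_def)
  moreover have "\<psi> \<one>\<^bsub>G\<^esub> = 1" using assms(2)[of "\<one>\<^bsub>G\<^esub>"] assms(3) by (simp add: is_trace_def)
  ultimately show ?thesis by (simp add: is_trace_def)
qed

lemma positive_definite_add:
  assumes "positive_definite G \<phi>" "positive_definite G \<psi>" "0 \<le> a" "0 \<le> b"
  shows "positive_definite G (\<lambda>g. complex_of_real a * \<phi> g + complex_of_real b * \<psi> g)"
proof (rule positive_definiteI)
  fix n :: nat and c :: "nat \<Rightarrow> complex" and g :: "nat \<Rightarrow> 'a"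
  assume g: "\<And>i. i < n \<Longrightarrow> g i \<in> carrier G"
  let ?h = "\<lambda>i j. inv\<^bsub>G\<^esub> (g i) \<otimes>\<^bsub>G\<^esub> g j"
  have e: "(\<Sum>i<n. \<Sum>j<n. cnj (c i) * c j * (complex_of_real a * \<phi> (?h i j) + complex_of_real b * \<psi> (?h i j))) =
    complex_of_real a * (\<Sum>i<n. \<Sum>j<n. cnj (c i) * c j * \<phi> (?h i j)) +
    complex_of_real b * (\<Sum>i<n. \<Sum>j<n. cnj (c i) * c j * \<psi> (?h i j))"
    by (simp add: sum_distrib_left sum.distrib algebra_simps)
  show "Im (\<Sum>i<n. \<Sum>j<n. cnj (c i) * c j * (complex_of_real a * \<phi> (?h i j) + complex_of_real b * \<psi> (?h i j))) = 0 \<and>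
    0 \<le> Re (\<Sum>i<n. \<Sum>j<n. cnj (c i) * c j * (complex_of_real a * \<phi> (?h i j) + complex_of_real b * \<psi> (?h i j)))"
    unfolding e using positive_definiteD[OF assms(1), of n g c] positive_definiteD[OF assms(2), of n g c] g assms(3,4)
    by simp
qed

lemma is_trace_convex:
  assumes "is_trace G \<phi>" "is_trace G \<psi>" "0 \<le> a" "0 \<le> b" "a + b = 1"
  shows "is_trace G (\<lambda>g. complex_of_real a * \<phi> g + complex_of_real b * \<psi> g)"
proof -
  have "complex_of_real a + complex_of_real b = 1" using assms(5) by (metis of_real_1 of_real_add)
  then show ?thesis
    using assms positive_definite_add[of G \<phi> \<psi> a b] by (simp add: is_trace_def conj_invariant_def)
qed

text \<open>Positivity on the two elements 1 and g with coefficients 1 and d: the choices d = 1 and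
  d = \<i> give Hermitian symmetry, and d = - cnj (\<phi> g) then gives 1 - |\<phi> g|^2 \<ge>
  0.\<close>

lemma norm_trace_le_1:
  assumes "group G" "is_trace G \<phi>" "g \<in> carrier G"
  shows "cmod (\<phi> g) \<le> 1"
proof -
  interpret group G by fact
  have pd: "positive_definite G \<phi>" and one: "\<phi> \<one>\<^bsub>G\<^esub> = 1" using assms(2) by (auto simp: is_trace_def)
  let ?i = "inv\<^bsub>G\<^esub> g"
  have P: "Im (1 + cnj d * d + d * \<phi> g + cnj d * \<phi> ?i) = 0 \<and> 0 \<le> Re (1 + cnj d * d + d * \<phi> g + cnj d * \<phi> ?i)" for d
  proof -
    define u where "u i = (if i = 0 then \<one>\<^bsub>G\<^esub> else g)" for i :: nat
    define c where "c i = (if i = 0 then 1 else d)" for i :: nat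
    have "(\<Sum>i<2. \<Sum>j<2. cnj (c i) * c j * \<phi> (inv\<^bsub>G\<^esub> (u i) \<otimes>\<^bsub>G\<^esub> u j)) =
       1 + cnj d * d + d * \<phi> g + cnj d * \<phi> ?i"
      using assms(3) one by (simp add: numeral_2_eq_2 u_def c_def algebra_simps)
    moreover have "u i \<in> carrier G" for i using assms(3) by (simp add: u_def)
    ultimately show ?thesis using positive_definiteD[OF pd, of 2 u c] by simp
  qed
  have "\<phi> ?i = cnj (\<phi> g)"
    using P[of 1] P[of \<i>] by (simp add: complex_eq_iff)
  then have "0 \<le> Re (1 + \<phi> g * cnj (\<phi> g) - cnj (\<phi> g) * \<phi> g - \<phi> g * cnj (\<phi> g))"
    using P[of "- cnj (\<phi> g)"] by simp
  then have "(cmod (\<phi> g))\<^sup>2 \<le> 1\<^sup>2" unfolding cmod_power2 by (simp add: power2_eq_square)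
  then show ?thesis by (rule power2_le_imp_le) simp
qed

text \<open>Each single condition involves only finitely many values of \<open>f p\<close> and is
  closed; closedness survives arbitrary intersections.\<close>

lemma closed_is_trace:
  fixes f :: "'c::topological_space \<Rightarrow> 'a \<Rightarrow> complex"
  assumes cont: "\<And>g. continuous_on UNIV (\<lambda>p. f p g)"
  shows "closed {p. is_trace G (f p)}"
proof -
  have 1: "closed {p. positive_definite G (f p)}"
    unfolding positive_definite_def Let_def
    by (intro closed_Collect_all closed_Collect_imp open_Collect_const closed_Collect_conj
        closed_Collect_eq closed_Collect_le continuous_intros cont)
  have 2: "closed {p. conj_invariant G (f p)}"
    unfolding conj_invariant_def Ball_def
    by (intro closed_Collect_all closed_Collect_imp open_Collect_const
        closed_Collect_eq continuous_intros cont)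
  have 3: "closed {p. f p \<one>\<^bsub>G\<^esub> = 1}"
    by (intro closed_Collect_eq continuous_intros cont)
  show ?thesis unfolding is_trace_def by (intro closed_Collect_conj 1 2 3)
qed

text \<open>Coded as real sequences, traces form a compact set, to which the midpoint form of
  Choquet's theorem applies. The bound is 2 and not 1 because it is asserted at every
  \<open>x\<close>: the real and imaginary parts are bounded by 1 everywhere, whereas being a trace
  is known only almost everywhere.\<close>

theorem trace_integral_characters:
  fixes G :: "('a, 'b) monoid_scheme"
  assumes G: "group G" "countable (carrier G)" and tr: "is_trace G \<phi>"
  obtains \<nu> :: "real measure" and \<xi> :: "real \<Rightarrow> 'a \<Rightarrow> complex"
  where "prob_space \<nu>" "\<And>g. (\<lambda>x. \<xi> x g) \<in> borel_measurable \<nu>" "\<And>g x. cmod (\<xi> x g) \<le> 2"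
    "\<And>g. g \<in> carrier G \<Longrightarrow> (\<integral>x. \<xi> x g \<partial>\<nu>) = \<phi> g"
    "AE x in \<nu>. is_character G (\<xi> x)"
proof -
  interpret group G by fact
  define idx where "idx = to_nat_on (carrier G)"
  have inj: "idx g = idx h \<longleftrightarrow> g = h" if "g \<in> carrier G" "h \<in> carrier G" for g h
    using that G(2) by (simp add: idx_def)
  \<comment> \<open>The even coordinate 2 * idx g holds the real part at g, the next odd one the
    imaginary part.\<close>
  define dec where "dec p g = complex_of_real (p (2 * idx g)) + \<i> * complex_of_real (p (2 * idx g + 1))"
    for p :: "nat \<Rightarrow> real" and g
  define enc where "enc \<psi> m = (if m div 2 \<in> idx ` carrier G then
      (let z = \<psi> (inv_into (carrier G) idx (m div 2)) in if even m then Re z else Im z) else 0)"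
    for \<psi> :: "'a \<Rightarrow> complex" and m :: nat
  have inj': "inj_on idx (carrier G)" using inj by (auto intro: inj_onI)
  have enc0: "enc \<psi> (2 * idx g) = Re (\<psi> g)" and enc1: "enc \<psi> (Suc (2 * idx g)) = Im (\<psi> g)"
    if "g \<in> carrier G" for \<psi> g
    using that inv_into_f_f[OF inj'] by (auto simp: enc_def Let_def)
  have dec_enc: "dec (enc \<psi>) g = \<psi> g" if "g \<in> carrier G" for \<psi> g
    using that by (simp add: dec_def enc0 enc1 complex_eq_iff)
  \<comment> \<open>Coordinates that belong to no group element occur when the carrier is finite.
    They are pinned to 0, since otherwise \<open>K\<close> would be unbounded.\<close>
  define K where "K = {p. is_trace G (dec p)} \<inter> {p. \<forall>m. m div 2 \<notin> idx ` carrier G \<longrightarrow> p m = 0}"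
  have bdd: "\<bar>p n\<bar> \<le> 1" if "p \<in> K" for p n
  proof (cases "n div 2 \<in> idx ` carrier G")
    case True
    then obtain g where g: "g \<in> carrier G" "n div 2 = idx g" by auto
    have "cmod (dec p g) \<le> 1" using norm_trace_le_1[OF G(1) _ g(1)] that by (simp add: K_def)
    then have "\<bar>Re (dec p g)\<bar> \<le> 1" "\<bar>Im (dec p g)\<bar> \<le> 1"
      using abs_Re_le_cmod abs_Im_le_cmod order.trans by blast+
    moreover have "n = 2 * idx g \<or> n = 2 * idx g + 1" using g(2) by presburger
    ultimately show ?thesis by (auto simp: dec_def)
  next
    case False
    then show ?thesis using that by (simp add: K_def)
  qed
  have cp: "continuous_on UNIV (\<lambda>p. p k)" for k :: nat
    by (rule continuous_on_product_coordinates)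
  have "closed K"
    unfolding K_def
    by (intro closed_Int closed_is_trace closed_Collect_all closed_Collect_imp open_Collect_const closed_Collect_eq)
      (auto simp: dec_def intro!: continuous_intros cp)
  moreover have "compact (PiE UNIV (\<lambda>_. {-1..1::real}) :: (nat \<Rightarrow> real) set)"
    using compactin_PiE[of "\<lambda>_. euclidean" "UNIV :: nat set" "\<lambda>_. {-1..1::real}"]
    by (simp add: euclidean_product_topology)
  moreover have "K \<subseteq> PiE UNIV (\<lambda>_. {-1..1})"
    using bdd by (auto simp: abs_le_iff)
  ultimately have cK: "compact K" by (metis compact_Int_closed inf.absorb_iff2)
  have encK: "enc \<psi> \<in> K" if "is_trace G \<psi>" for \<psi>
  proof -
    have "is_trace G (dec (enc \<psi>))" by (rule is_trace_cong[OF G(1) _ that]) (simp add: dec_enc)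
    then show ?thesis by (simp add: K_def enc_def)
  qed
  obtain \<nu> :: "real measure" and s :: "real \<Rightarrow> nat \<Rightarrow> real" where
    \<nu>: "prob_space \<nu>" "\<And>n. (\<lambda>x. s x n) \<in> borel_measurable \<nu>" "\<And>n x. \<bar>s x n\<bar> \<le> 1"
    "\<And>n. (\<integral>x. s x n \<partial>\<nu>) = enc \<phi> n"
    "AE x in \<nu>. s x \<in> K \<and> (\<forall>q\<in>K. \<forall>r\<in>K. (\<forall>n. q n + r n = 2 * s x n) \<longrightarrow> q = r)"
    using choquet_sequences[OF cK _ encK[OF tr]] bdd by blast
  interpret \<nu>: prob_space \<nu> by fact
  have ext: "is_character G (dec p)"
    if p: "p \<in> K" and e: "\<forall>q\<in>K. \<forall>r\<in>K. (\<forall>n. q n + r n = 2 * p n) \<longrightarrow> q = r" for p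
    unfolding is_character_def
  proof (intro conjI allI impI; (elim conjE)?)
    show "is_trace G (dec p)" using p by (simp add: K_def)
    fix \<psi>1 \<psi>2 and t :: real
    assume tr12: "is_trace G \<psi>1" "is_trace G \<psi>2" and t: "0 < t" "t < 1"
      and eq: "\<forall>g\<in>carrier G. dec p g = complex_of_real t * \<psi>1 g + complex_of_real (1 - t) * \<psi>2 g"
    \<comment> \<open>A character is tested against every weight t, but p is known to be extreme
      only for midpoints. Shifting the weight by \<epsilon> in both directions gives traces
      \<open>q\<close> and \<open>r\<close> with midpoint p; their difference is 2 \<epsilon>
      (\<psi>1 - \<psi>2), so q = r forces \<psi>1 = \<psi>2.\<close>
    define \<epsilon> where "\<epsilon> = min t (1 - t)"
    have \<epsilon>: "\<epsilon> > 0" "\<epsilon> \<le> t" "\<epsilon> \<le> 1 - t" using t by (auto simp: \<epsilon>_def)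
    define q where "q = (\<lambda>g. complex_of_real (t + \<epsilon>) * \<psi>1 g + complex_of_real (1 - t - \<epsilon>) * \<psi>2 g)"
    define r where "r = (\<lambda>g. complex_of_real (t - \<epsilon>) * \<psi>1 g + complex_of_real (1 - t + \<epsilon>) * \<psi>2 g)"
    have "is_trace G q" unfolding q_def using \<epsilon> t by (intro is_trace_convex tr12) auto
    moreover have "is_trace G r" unfolding r_def using \<epsilon> t by (intro is_trace_convex tr12) auto
    moreover have "\<forall>n. enc q n + enc r n = 2 * p n"
    proof
      fix n
      show "enc q n + enc r n = 2 * p n"
      proof (cases "n div 2 \<in> idx ` carrier G")
        case True
        then obtain g where g: "g \<in> carrier G" "n div 2 = idx g" by auto
        have d: "q g + r g = 2 * dec p g"
        proof -
          have "q g + r g = 2 * (complex_of_real t * \<psi>1 g + complex_of_real (1 - t) * \<psi>2 g)"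
            by (simp add: q_def r_def algebra_simps)
          then show ?thesis using eq g(1) by simp
        qed
        have "n = 2 * idx g \<or> n = Suc (2 * idx g)" using g(2) by presburger
        then show ?thesis
          using arg_cong[OF d, of Re] arg_cong[OF d, of Im] by (auto simp: enc0 enc1 g(1) dec_def)
      next
        case False
        then show ?thesis using p by (simp add: K_def enc_def)
      qed
    qed
    ultimately have "enc q = enc r" using e encK by blast
    then have qr: "q g = r g" if "g \<in> carrier G" for g using dec_enc[OF that] by metis
    have "\<psi>1 g = \<psi>2 g" if "g \<in> carrier G" for g
    proof -
      have "complex_of_real (2 * \<epsilon>) * (\<psi>1 g - \<psi>2 g) = q g - r g"
        by (simp add: q_def r_def algebra_simps)
      then show ?thesis using qr[OF that] \<epsilon>(1) by simp
    qed
    then show "\<forall>g\<in>carrier G. \<psi>1 g = dec p g \<and> \<psi>2 g = dec p g"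
      using eq by (auto simp: algebra_simps)
  qed
  show ?thesis
  proof (rule that[of \<nu> "\<lambda>x. dec (s x)"])
    show "prob_space \<nu>" by fact
    show "(\<lambda>x. dec (s x) g) \<in> borel_measurable \<nu>" for g
      unfolding dec_def using \<nu>(2) by measurable
    show "cmod (dec (s x) g) \<le> 2" for g x
    proof -
      have "cmod (dec (s x) g) \<le> \<bar>s x (2 * idx g)\<bar> + \<bar>s x (2 * idx g + 1)\<bar>"
        unfolding dec_def by (rule order.trans[OF norm_triangle_ineq]) (simp add: norm_mult)
      then show ?thesis using \<nu>(3)[of x "2 * idx g"] \<nu>(3)[of x "2 * idx g + 1"] by linarith
    qed
    show "(\<integral>x. dec (s x) g \<partial>\<nu>) = \<phi> g" if g: "g \<in> carrier G" for g
    proof -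
      have i: "integrable \<nu> (\<lambda>x. s x n)" for n
        by (rule \<nu>.integrable_const_bound[of _ 1]) (use \<nu>(2,3) in auto)
      have "(\<integral>x. dec (s x) g \<partial>\<nu>) = dec (\<lambda>n. \<integral>x. s x n \<partial>\<nu>) g"
        unfolding dec_def by (subst Bochner_Integration.integral_add) (auto intro!: integrable_of_real i)
      also have "\<dots> = \<phi> g" using \<nu>(4) dec_enc[OF g, of \<phi>] by simp
      finally show ?thesis .
    qed
    show "AE x in \<nu>. is_character G (dec (s x))"
      using \<nu>(5) by eventually_elim (use ext in blast)
  qed
qed

section \<open>Finite-dimensional components\<close>

lemma mat_mult_entry:
  assumes "A \<in> carrier_mat n n" "B \<in> carrier_mat n n" "i < n" "j < n"
  shows "(A * B) $$ (i, j) = (\<Sum>k<n. A $$ (i, k) * B $$ (k, j))"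
  using assms by (simp add: scalar_prod_def atLeast0LessThan)

lemma mat_trace_mult:
  assumes "A \<in> carrier_mat n n" "B \<in> carrier_mat n n"
  shows "mat_trace (A * B) = (\<Sum>i<n. \<Sum>k<n. A $$ (i, k) * B $$ (k, i))"
  using assms by (auto simp: mat_trace_def mat_mult_entry simp del: index_mult_mat(1) intro!: sum.cong)

lemma mat_trace_mult_commute:
  assumes "A \<in> carrier_mat n n" "B \<in> carrier_mat n n"
  shows "mat_trace (A * B) = mat_trace (B * A)"
  unfolding mat_trace_mult[OF assms] mat_trace_mult[OF assms(2,1)]
  by (subst sum.swap) (simp add: mult.commute)

lemma adj_mat_carrier: "A \<in> carrier_mat n n \<Longrightarrow> adj_mat A \<in> carrier_mat n n"
  by (simp add: adj_mat_def)

lemma adj_mat_entry: "A \<in> carrier_mat n n \<Longrightarrow> i < n \<Longrightarrow> j < n \<Longrightarrow> adj_mat A $$ (i, j) = cnj (A $$ (j, i))"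
  by (simp add: adj_mat_def)

text \<open>Conjugation by a unitary preserves the trace, so countably many classes of
  representations give only countably many finite-dimensional characters.\<close>

lemma equiv_rep_mat_trace:
  assumes eq: "equiv_rep G (n, \<pi>) (m, \<sigma>)" and rep: "unitary_rep G n \<pi>" "unitary_rep G m \<sigma>" and g: "g \<in> carrier G"
  shows "mat_trace (\<pi> g) = mat_trace (\<sigma> g)"
proof -
  obtain U where U: "unitary_mat n U" and UI: "U * \<pi> g = \<sigma> g * U" and mn: "m = n"
    using eq g unfolding equiv_rep_def fst_conv snd_conv by blast
  have c: "U \<in> carrier_mat n n" "\<pi> g \<in> carrier_mat n n" "\<sigma> g \<in> carrier_mat n n" "adj_mat U \<in> carrier_mat n n"
  proof -
    have "unitary_mat n (\<pi> g)" "unitary_mat n (\<sigma> g)" using rep g mn by (simp_all add: unitary_rep_def)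
    with U show "U \<in> carrier_mat n n" "\<pi> g \<in> carrier_mat n n" "\<sigma> g \<in> carrier_mat n n" "adj_mat U \<in> carrier_mat n n"
      by (simp_all add: unitary_mat_def adj_mat_carrier)
  qed
  have u: "adj_mat U * U = 1\<^sub>m n" "U * adj_mat U = 1\<^sub>m n" using U by (simp_all add: unitary_mat_def)
  have "\<pi> g = adj_mat U * U * \<pi> g" using u c by simp
  also have "\<dots> = adj_mat U * (\<sigma> g * U)" unfolding UI[symmetric] by (rule assoc_mult_mat[OF c(4,1,2)])
  finally have "mat_trace (\<pi> g) = mat_trace ((\<sigma> g * U) * adj_mat U)"
    using mat_trace_mult_commute[of "adj_mat U" n "\<sigma> g * U"] c by simp
  also have "(\<sigma> g * U) * adj_mat U = \<sigma> g" 
    unfolding assoc_mult_mat[OF c(3,1,4)] u(2) using c(3) by simp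
  finally show ?thesis .
qed

text \<open>The matrix of g^-1 h is the adjoint of \<open>\<pi> g\<close> times
  \<open>\<pi> h\<close>, so the trace kernel is the Gram kernel of the matrices for the
  Hilbert-Schmidt inner product, written out in their n^2 entries.\<close>

lemma unitary_rep_trace_formula:
  assumes G: "group G" and rep: "unitary_rep G n \<pi>" and gh: "g \<in> carrier G" "h \<in> carrier G"
  shows "mat_trace (\<pi> (inv\<^bsub>G\<^esub> g \<otimes>\<^bsub>G\<^esub> h)) =
    (\<Sum>x\<in>{..<n} \<times> {..<n}. cnj (\<pi> g $$ x) * \<pi> h $$ x)"
proof -
  interpret group G by fact
  let ?k = "inv\<^bsub>G\<^esub> g \<otimes>\<^bsub>G\<^esub> h"
  have k: "?k \<in> carrier G" using gh by simp
  have U: "unitary_mat n (\<pi> x)" if "x \<in> carrier G" for x using rep that by (simp add: unitary_rep_def)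
  have c: "\<pi> g \<in> carrier_mat n n" "\<pi> h \<in> carrier_mat n n" "\<pi> ?k \<in> carrier_mat n n"
    and u: "adj_mat (\<pi> g) * \<pi> g = 1\<^sub>m n"
    using U[OF gh(1)] U[OF gh(2)] U[OF k] unfolding unitary_mat_def by blast+
  have a: "adj_mat (\<pi> g) \<in> carrier_mat n n" using c(1) by (rule adj_mat_carrier)
  have "g \<otimes>\<^bsub>G\<^esub> ?k = h" using gh by (simp add: m_assoc[symmetric])
  then have "\<pi> h = \<pi> g * \<pi> ?k" using rep gh k by (metis unitary_rep_def)
  then have "adj_mat (\<pi> g) * \<pi> h = adj_mat (\<pi> g) * \<pi> g * \<pi> ?k"
    using assoc_mult_mat[OF a c(1) c(3)] by simp
  then have "\<pi> ?k = adj_mat (\<pi> g) * \<pi> h" using c(3) u by simp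
  then have "mat_trace (\<pi> ?k) = (\<Sum>i<n. \<Sum>k<n. adj_mat (\<pi> g) $$ (i, k) * \<pi> h $$ (k, i))"
    using mat_trace_mult[OF a c(2)] by simp
  also have "\<dots> = (\<Sum>i<n. \<Sum>k<n. cnj (\<pi> g $$ (k, i)) * \<pi> h $$ (k, i))"
    by (intro sum.cong refl) (simp add: adj_mat_entry[OF c(1)])
  also have "\<dots> = (\<Sum>k<n. \<Sum>i<n. cnj (\<pi> g $$ (k, i)) * \<pi> h $$ (k, i))" by (rule sum.swap)
  also have "\<dots> = (\<Sum>x\<in>{..<n} \<times> {..<n}. cnj (\<pi> g $$ x) * \<pi> h $$ x)"
    by (simp add: sum.cartesian_product split_def)
  finally show ?thesis .
qed

lemma unitary_rep_sum_squares:
  assumes G: "group G" and rep: "unitary_rep G n \<pi>" and g: "g \<in> carrier G"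
  shows "(\<Sum>x\<in>{..<n} \<times> {..<n}. (cmod (\<pi> g $$ x))\<^sup>2) = n"
proof -
  have c: "\<pi> g \<in> carrier_mat n n" and u: "adj_mat (\<pi> g) * \<pi> g = 1\<^sub>m n"
    using rep g by (auto simp: unitary_rep_def unitary_mat_def)
  have "complex_of_real (\<Sum>x\<in>{..<n} \<times> {..<n}. (cmod (\<pi> g $$ x))\<^sup>2) =
      (\<Sum>x\<in>{..<n} \<times> {..<n}. cnj (\<pi> g $$ x) * \<pi> g $$ x)"
    by (simp add: complex_norm_square mult.commute del: of_real_power)
  also have "\<dots> = (\<Sum>k<n. \<Sum>i<n. cnj (\<pi> g $$ (k, i)) * \<pi> g $$ (k, i))"
    by (simp add: sum.cartesian_product split_def)
  also have "\<dots> = (\<Sum>i<n. \<Sum>k<n. cnj (\<pi> g $$ (k, i)) * \<pi> g $$ (k, i))" by (rule sum.swap)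
  also have "\<dots> = mat_trace (adj_mat (\<pi> g) * \<pi> g)"
    unfolding mat_trace_mult[OF adj_mat_carrier[OF c] c]
    by (intro sum.cong refl) (simp add: adj_mat_entry[OF c])
  also have "\<dots> = of_nat n" unfolding u by (simp add: mat_trace_def)
  finally show ?thesis by (metis of_real_eq_iff of_real_of_nat_eq)
qed

text \<open>Rows of a unitary matrix are unit vectors, so diagonal entries have modulus at most
  1.\<close>

lemma unitary_rep_norm_trace_le:
  assumes rep: "unitary_rep G n \<pi>" and g: "g \<in> carrier G"
  shows "cmod (mat_trace (\<pi> g)) \<le> n"
proof -
  have c: "\<pi> g \<in> carrier_mat n n" and u: "\<pi> g * adj_mat (\<pi> g) = 1\<^sub>m n"
    using rep g by (auto simp: unitary_rep_def unitary_mat_def)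
  have le: "cmod (\<pi> g $$ (i, i)) \<le> 1" if i: "i < n" for i
  proof -
    have "complex_of_real (\<Sum>k<n. (cmod (\<pi> g $$ (i, k)))\<^sup>2) = (\<Sum>k<n. \<pi> g $$ (i, k) * cnj (\<pi> g $$ (i, k)))"
      by (simp add: complex_norm_square del: of_real_power)
    also have "\<dots> = (\<pi> g * adj_mat (\<pi> g)) $$ (i, i)"
      unfolding mat_mult_entry[OF c adj_mat_carrier[OF c] i i]
      by (intro sum.cong refl) (simp add: adj_mat_entry[OF c] i)
    also have "\<dots> = complex_of_real 1" unfolding u using i by simp
    finally have "(\<Sum>k<n. (cmod (\<pi> g $$ (i, k)))\<^sup>2) = 1" unfolding of_real_eq_iff .
    moreover have "(cmod (\<pi> g $$ (i, i)))\<^sup>2 \<le> (\<Sum>k<n. (cmod (\<pi> g $$ (i, k)))\<^sup>2)"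
      using i by (intro member_le_sum) auto
    ultimately show ?thesis by (simp add: abs_square_le_1)
  qed
  have "cmod (mat_trace (\<pi> g)) \<le> (\<Sum>i<n. cmod (\<pi> g $$ (i, i)))"
    using c by (auto simp: mat_trace_def intro: norm_sum)
  also have "\<dots> \<le> (\<Sum>i<n. 1)" by (intro sum_mono le) auto
  finally show ?thesis by simp
qed

text \<open>The k by k Gram matrix and the \<open>I\<close> by \<open>I\<close> matrix
  \<open>C\<close> are the two products of one matrix with its adjoint, so their Hilbert-Schmidt
  norms agree. Only the diagonal of \<open>C\<close> is kept, and Cauchy-Schwarz over its
  \<open>card I\<close> entries loses a factor that does not grow with k.\<close>

lemma gram_sum_squares_ge:
  fixes p :: "nat \<Rightarrow> 'i \<Rightarrow> complex"
  assumes I: "finite I"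
  shows "(\<Sum>i<k. \<Sum>x\<in>I. (cmod (p i x))\<^sup>2)\<^sup>2 \<le>
    (\<Sum>i<k. \<Sum>j<k. (cmod (\<Sum>x\<in>I. cnj (p i x) * p j x))\<^sup>2) * card I"
proof -
  define C where "C x y = (\<Sum>i<k. cnj (p i x) * p i y)" for x y
  have "complex_of_real (\<Sum>i<k. \<Sum>j<k. (cmod (\<Sum>x\<in>I. cnj (p i x) * p j x))\<^sup>2) =
    (\<Sum>i<k. \<Sum>j<k. \<Sum>x\<in>I. \<Sum>y\<in>I. (cnj (p i x) * p i y) * cnj (cnj (p j x) * p j y))"
  proof -
    have "complex_of_real ((cmod (\<Sum>x\<in>I. cnj (p i x) * p j x))\<^sup>2) =
      (\<Sum>x\<in>I. \<Sum>y\<in>I. (cnj (p i x) * p i y) * cnj (cnj (p j x) * p j y))" for i j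
      unfolding complex_norm_square cnj_sum sum_product
      by (intro sum.cong refl) (simp add: mult_ac)
    then show ?thesis by (simp only: of_real_sum)
  qed
  also have "\<dots> = (\<Sum>x\<in>I. \<Sum>y\<in>I. \<Sum>i<k. \<Sum>j<k. (cnj (p i x) * p i y) * cnj (cnj (p j x) * p j y))"
    (is "?L = ?R")
  proof -
    have "?L = (\<Sum>i<k. \<Sum>x\<in>I. \<Sum>y\<in>I. \<Sum>j<k. (cnj (p i x) * p i y) * cnj (cnj (p j x) * p j y))"
      by (intro sum.cong refl, subst sum.swap, intro sum.cong refl, rule sum.swap)
    also have "\<dots> = ?R"
      by (subst sum.swap, intro sum.cong refl, rule sum.swap)
    finally show ?thesis .
  qed
  also have "\<dots> = (\<Sum>x\<in>I. \<Sum>y\<in>I. C x y * cnj (C x y))"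
    by (simp add: C_def sum_product)
  also have "\<dots> = complex_of_real (\<Sum>x\<in>I. \<Sum>y\<in>I. (cmod (C x y))\<^sup>2)"
    by (simp add: complex_norm_square del: of_real_power)
  finally have eq: "(\<Sum>i<k. \<Sum>j<k. (cmod (\<Sum>x\<in>I. cnj (p i x) * p j x))\<^sup>2) = (\<Sum>x\<in>I. \<Sum>y\<in>I. (cmod (C x y))\<^sup>2)"
    by (simp only: of_real_eq_iff)
  have Cxx: "C x x = complex_of_real (\<Sum>i<k. (cmod (p i x))\<^sup>2)" for x
    by (simp add: C_def complex_norm_square mult.commute del: of_real_power)
  have "(\<Sum>i<k. \<Sum>x\<in>I. (cmod (p i x))\<^sup>2)\<^sup>2 = (\<Sum>x\<in>I. cmod (C x x))\<^sup>2"
  proof -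
    have "cmod (C x x) = (\<Sum>i<k. (cmod (p i x))\<^sup>2)" for x
      unfolding Cxx norm_of_real by (simp add: sum_nonneg)
    then show ?thesis by (simp add: sum.swap[of _ I])
  qed
  also have "\<dots> \<le> (\<Sum>x\<in>I. (cmod (C x x))\<^sup>2) * card I"
    by (rule sum_squared_le_sum_of_squares)
  also have "\<dots> \<le> (\<Sum>x\<in>I. \<Sum>y\<in>I. (cmod (C x y))\<^sup>2) * card I"
    using I by (intro mult_right_mono sum_mono member_le_sum) auto
  finally show ?thesis unfolding eq .
qed

text \<open>For each matrix position x the form is tested on the conjugates of the entries
  \<open>p i x\<close>; summing over x multiplies the kernel entrywise by the conjugate of
  \<open>\<tau>\<close>. This gives (\<alpha> / n) \<Sum>|\<tau>|^2 \<le> \<Sum> f Re \<tau> \<le> n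
  \<Sum> f, and the Gram inequality bounds \<Sum>|\<tau>|^2 below by k^2.\<close>

lemma finite_dim_component_lower_bound:
  assumes G: "group G" and rep: "unitary_rep G n \<pi>" and n: "n \<ge> 1" and \<alpha>: "\<alpha> \<ge> 0"
    and pd: "positive_definite G (\<lambda>g. complex_of_real (f g) - complex_of_real \<alpha> * (mat_trace (\<pi> g) / of_nat n))"
    and f: "\<And>g. f g \<ge> 0" and g: "\<And>i. i < k \<Longrightarrow> g i \<in> carrier G"
  shows "\<alpha> * (real k)\<^sup>2 / (real n)\<^sup>2 \<le> (\<Sum>i<k. \<Sum>j<k. f (inv\<^bsub>G\<^esub> (g i) \<otimes>\<^bsub>G\<^esub> g j))"
proof -
  interpret group G by fact
  define I where "I = {..<n} \<times> {..<n}"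
  define p where "p i x = \<pi> (g i) $$ x" for i x
  define h where "h i j = inv\<^bsub>G\<^esub> (g i) \<otimes>\<^bsub>G\<^esub> g j" for i j
  define \<tau> where "\<tau> i j = (\<Sum>x\<in>I. cnj (p i x) * p j x)" for i j
  have \<tau>: "mat_trace (\<pi> (h i j)) = \<tau> i j" if "i < k" "j < k" for i j
    unfolding h_def \<tau>_def p_def I_def by (rule unitary_rep_trace_formula[OF G rep g g]) (use that in auto)
  have \<tau>n: "cmod (\<tau> i j) \<le> n" if "i < k" "j < k" for i j
  proof -
    have "h i j \<in> carrier G" using g that by (simp add: h_def)
    then show ?thesis using unitary_rep_norm_trace_le[OF rep] \<tau>[OF that] by metis
  qed
  define \<psi> where "\<psi> i j = complex_of_real (f (h i j)) - complex_of_real \<alpha> * (\<tau> i j / of_nat n)" for i j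
  have pos: "0 \<le> Re (\<Sum>i<k. \<Sum>j<k. cnj (cnj (p i x)) * cnj (p j x) * \<psi> i j)" for x
  proof -
    have "(\<Sum>i<k. \<Sum>j<k. cnj (cnj (p i x)) * cnj (p j x) * \<psi> i j) =
      (\<Sum>i<k. \<Sum>j<k. cnj (cnj (p i x)) * cnj (p j x) * (complex_of_real (f (h i j)) - complex_of_real \<alpha> * (mat_trace (\<pi> (h i j)) / of_nat n)))"
      by (intro sum.cong refl) (simp add: \<psi>_def \<tau>)
    then show ?thesis
      using positive_definiteD(2)[OF pd, of k g "\<lambda>i. cnj (p i x)"] g by (simp add: h_def)
  qed
  have "0 \<le> (\<Sum>x\<in>I. Re (\<Sum>i<k. \<Sum>j<k. cnj (cnj (p i x)) * cnj (p j x) * \<psi> i j))"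
    by (intro sum_nonneg pos)
  also have "\<dots> = Re (\<Sum>i<k. \<Sum>j<k. \<Sum>x\<in>I. cnj (cnj (p i x)) * cnj (p j x) * \<psi> i j)"
  proof -
    have "(\<Sum>x\<in>I. \<Sum>i<k. \<Sum>j<k. cnj (cnj (p i x)) * cnj (p j x) * \<psi> i j) =
      (\<Sum>i<k. \<Sum>j<k. \<Sum>x\<in>I. cnj (cnj (p i x)) * cnj (p j x) * \<psi> i j)"
      by (subst sum.swap, intro sum.cong refl, rule sum.swap)
    then show ?thesis by (metis Re_sum)
  qed
  also have "(\<Sum>i<k. \<Sum>j<k. \<Sum>x\<in>I. cnj (cnj (p i x)) * cnj (p j x) * \<psi> i j) =
     (\<Sum>i<k. \<Sum>j<k. cnj (\<tau> i j) * \<psi> i j)"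
    by (simp add: \<tau>_def sum_distrib_right)
  also have "Re \<dots> = (\<Sum>i<k. \<Sum>j<k. f (h i j) * Re (\<tau> i j) - \<alpha> / n * (cmod (\<tau> i j))\<^sup>2)"
  proof -
    have "cnj (\<tau> i j) * \<psi> i j = complex_of_real (f (h i j)) * cnj (\<tau> i j) - complex_of_real (\<alpha> / n * (cmod (\<tau> i j))\<^sup>2)" for i j
      unfolding of_real_mult complex_norm_square by (simp add: \<psi>_def algebra_simps)
    then show ?thesis by simp
  qed
  \<comment> \<open>Because f \<ge> 0, the real part of \<open>\<tau>\<close> may be replaced by its
    upper bound n, which removes the phases from the first term.\<close>
  also have "\<dots> \<le> (\<Sum>i<k. \<Sum>j<k. f (h i j) * n - \<alpha> / n * (cmod (\<tau> i j))\<^sup>2)"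
  proof (intro sum_mono diff_right_mono mult_left_mono f)
    fix i j assume "i \<in> {..<k}" "j \<in> {..<k}"
    then show "Re (\<tau> i j) \<le> n" using \<tau>n[of i j] complex_Re_le_cmod[of "\<tau> i j"] by auto
  qed
  also have "\<dots> = (\<Sum>i<k. \<Sum>j<k. f (h i j)) * n - \<alpha> / n * (\<Sum>i<k. \<Sum>j<k. (cmod (\<tau> i j))\<^sup>2)"
    by (simp add: sum_subtractf sum_distrib_left sum_distrib_right)
  finally have 1: "\<alpha> / n * (\<Sum>i<k. \<Sum>j<k. (cmod (\<tau> i j))\<^sup>2) \<le> (\<Sum>i<k. \<Sum>j<k. f (h i j)) * n" by simp
  \<comment> \<open>Each of the k matrices has squared Hilbert-Schmidt norm n, and there are n^2
    positions, so a factor n^2 cancels.\<close>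
  have "(real k * real n)\<^sup>2 = (\<Sum>i<k. \<Sum>x\<in>I. (cmod (p i x))\<^sup>2)\<^sup>2"
    using unitary_rep_sum_squares[OF G rep g] by (simp add: p_def I_def)
  also have "\<dots> \<le> (\<Sum>i<k. \<Sum>j<k. (cmod (\<tau> i j))\<^sup>2) * card I"
    unfolding \<tau>_def by (rule gram_sum_squares_ge) (simp add: I_def)
  finally have "(real k * real n)\<^sup>2 \<le> (\<Sum>i<k. \<Sum>j<k. (cmod (\<tau> i j))\<^sup>2) * card I" .
  then have "(real k)\<^sup>2 * (real n)\<^sup>2 \<le> (\<Sum>i<k. \<Sum>j<k. (cmod (\<tau> i j))\<^sup>2) * (real n)\<^sup>2"
  proof -
    have "real (card I) = (real n)\<^sup>2" by (simp add: I_def power2_eq_square)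
    with \<open>(real k * real n)\<^sup>2 \<le> _\<close> show ?thesis by (simp only: power_mult_distrib)
  qed
  then have "(real k)\<^sup>2 \<le> (\<Sum>i<k. \<Sum>j<k. (cmod (\<tau> i j))\<^sup>2)" using n by simp
  then have "\<alpha> / n * (real k)\<^sup>2 \<le> \<alpha> / n * (\<Sum>i<k. \<Sum>j<k. (cmod (\<tau> i j))\<^sup>2)"
    using \<alpha> by (intro mult_left_mono) auto
  with 1 have "\<alpha> / n * (real k)\<^sup>2 \<le> (\<Sum>i<k. \<Sum>j<k. f (h i j)) * n" by linarith
  then show ?thesis using n by (simp add: h_def field_simps power2_eq_square)
qed

text \<open>On the set \<open>\<Omega> q\<close>, where the random character equals
  \<open>\<kappa> q\<close>, the integral contributes the mass of that set times
  \<open>\<kappa> q\<close>. What remains is an integral of characters over the complement, hence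
  positive definite.\<close>

lemma rigid_trace_finite_dim_component:
  assumes G: "group G" "countable (carrier G)" and rigid: "character_rigid G"
    and fd: "countably_many_fd_reps G" and tr: "is_trace G \<phi>"
    and g0: "g0 \<in> carrier G - center G" "\<phi> g0 \<noteq> 0"
  obtains n \<pi> and \<alpha> :: real where "unitary_rep G n \<pi>" "n \<ge> 1" "\<alpha> > 0"
    "positive_definite G (\<lambda>g. \<phi> g - complex_of_real \<alpha> * (mat_trace (\<pi> g) / of_nat n))"
proof -
  interpret group G by fact
  obtain \<nu> :: "real measure" and \<xi> :: "real \<Rightarrow> 'a \<Rightarrow> complex" where
    \<nu>: "prob_space \<nu>" and \<xi>m[measurable]: "\<And>g. (\<lambda>x. \<xi> x g) \<in> borel_measurable \<nu>"
    and \<xi>b: "\<And>g x. cmod (\<xi> x g) \<le> 2" and \<xi>i: "\<And>g. g \<in> carrier G \<Longrightarrow> (\<integral>x. \<xi> x g \<partial>\<nu>) = \<phi> g"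
    and \<xi>c: "AE x in \<nu>. is_character G (\<xi> x)"
    using trace_integral_characters[OF G tr] by blast
  interpret \<nu>: prob_space \<nu> by fact
  obtain S where S: "countable S" "\<And>n \<pi>. (n, \<pi>) \<in> S \<Longrightarrow> unitary_rep G n \<pi>"
    "\<And>n \<pi>. unitary_rep G n \<pi> \<Longrightarrow> \<exists>q\<in>S. equiv_rep G (n, \<pi>) q"
    using fd unfolding countably_many_fd_reps_def by (metis case_prodD)
  \<comment> \<open>Dimension 0 is left out because the normalisation divides by the
    dimension.\<close>
  define S' where "S' = {q \<in> S. fst q \<ge> 1}"
  have cS': "countable S'" using S(1) by (simp add: S'_def)
  define \<kappa> where "\<kappa> q g = mat_trace (snd q g) / of_nat (fst q)" for q :: "nat \<times> ('a \<Rightarrow> complex mat)" and g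
  define \<Omega> where "\<Omega> q = {x \<in> space \<nu>. \<forall>g\<in>carrier G. \<xi> x g = \<kappa> q g}" for q
  have \<Omega>m[measurable]: "\<Omega> q \<in> sets \<nu>" for q
    unfolding \<Omega>_def using G(2) by measurable
  have dich: "AE x in \<nu>. (\<exists>q\<in>S'. x \<in> \<Omega> q) \<or> \<xi> x g0 = 0"
    using \<xi>c AE_space
  proof eventually_elim
    case (elim x)
    show ?case
    proof (cases "finite_dim_character G (\<xi> x)")
      case True
      then obtain n \<pi> where \<pi>: "irreducible_rep G n \<pi>" "\<And>g. g \<in> carrier G \<Longrightarrow> \<xi> x g = mat_trace (\<pi> g) / of_nat n"
        by (auto simp: finite_dim_character_def)
      have rep: "unitary_rep G n \<pi>" "n \<ge> 1" using \<pi>(1) by (auto simp: irreducible_rep_def)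
      obtain m \<sigma> where q: "(m, \<sigma>) \<in> S" "equiv_rep G (n, \<pi>) (m, \<sigma>)" using S(3)[OF rep(1)] by auto
      have "m = n" using q(2) by (simp add: equiv_rep_def)
      have "mat_trace (\<pi> g) = mat_trace (\<sigma> g)" if "g \<in> carrier G" for g
        by (rule equiv_rep_mat_trace[OF q(2) rep(1) S(2)[OF q(1)] that])
      then have "x \<in> \<Omega> (m, \<sigma>)" using \<pi>(2) elim(2) \<open>m = n\<close> by (simp add: \<Omega>_def \<kappa>_def)
      moreover have "(m, \<sigma>) \<in> S'" using q(1) rep(2) \<open>m = n\<close> by (simp add: S'_def)
      ultimately show ?thesis by blast
    next
      case False
      then show ?thesis using rigid elim(1) g0(1) by (auto simp: character_rigid_def)
    qed
  qed
  \<comment> \<open>Were every \<open>\<Omega> q\<close> null, so would be their countable union;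
    the random character would then vanish at \<open>g0\<close> almost surely, and \<phi> g0 would
    be 0.\<close>
  have "\<exists>q\<in>S'. \<nu>.prob (\<Omega> q) \<noteq> 0"
  proof (rule ccontr)
    assume "\<not> (\<exists>q\<in>S'. \<nu>.prob (\<Omega> q) \<noteq> 0)"
    then have "\<forall>q\<in>S'. AE x in \<nu>. x \<notin> \<Omega> q" using \<nu>.prob_eq_0[OF \<Omega>m] by auto
    then have "AE x in \<nu>. \<forall>q\<in>S'. x \<notin> \<Omega> q" using cS' by (simp add: AE_ball_countable)
    with dich have "AE x in \<nu>. \<xi> x g0 = 0" by eventually_elim auto
    then have "(\<integral>x. \<xi> x g0 \<partial>\<nu>) = 0" by (rule integral_eq_zero_AE)
    with \<xi>i g0 show False by simp
  qed
  then obtain n \<pi> where q: "(n, \<pi>) \<in> S'" "\<nu>.prob (\<Omega> (n, \<pi>)) \<noteq> 0" by auto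
  define \<alpha> where "\<alpha> = \<nu>.prob (\<Omega> (n, \<pi>))"
  have \<alpha>: "\<alpha> > 0" using q(2) measure_nonneg[of \<nu> "\<Omega> (n, \<pi>)"] unfolding \<alpha>_def by linarith
  let ?J = "\<lambda>x. complex_of_real (indicator (\<Omega> (n, \<pi>)) x)"
  have int: "integrable \<nu> (\<lambda>x. \<xi> x g)" for g
    by (rule \<nu>.integrable_const_bound[of _ 2]) (use \<xi>b in auto)
  have intJ: "integrable \<nu> (\<lambda>x. ?J x * \<xi> x g)" for g
    by (rule \<nu>.integrable_const_bound[of _ 2]) (use \<xi>b in \<open>auto simp: indicator_def\<close>)
  have "positive_definite G (\<lambda>g. \<phi> g - complex_of_real \<alpha> * \<kappa> (n, \<pi>) g)"
  proof (rule positive_definiteI)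
    fix k :: nat and c :: "nat \<Rightarrow> complex" and g :: "nat \<Rightarrow> 'a"
    assume g: "\<And>i. i < k \<Longrightarrow> g i \<in> carrier G"
    define h where "h i j = inv\<^bsub>G\<^esub> (g i) \<otimes>\<^bsub>G\<^esub> g j" for i j
    \<comment> \<open>The quadratic form of the character at x with the part on
      \<open>\<Omega> (n, \<pi>)\<close> removed: 0 on that set and nonnegative almost everywhere
      else.\<close>
    define Z where "Z x = (\<Sum>i<k. \<Sum>j<k. cnj (c i) * c j * (\<xi> x (h i j) - ?J x * \<xi> x (h i j)))" for x
    have iZ: "integrable \<nu> Z"
      unfolding Z_def using int intJ by (intro Bochner_Integration.integrable_sum integrable_mult_right Bochner_Integration.integrable_diff)
    have val: "\<phi> (h i j) - complex_of_real \<alpha> * \<kappa> (n, \<pi>) (h i j) = (\<integral>x. \<xi> x (h i j) - ?J x * \<xi> x (h i j) \<partial>\<nu>)"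
      if "i < k" "j < k" for i j
    proof -
      have h: "h i j \<in> carrier G" using g that by (simp add: h_def)
      have "(\<integral>x. ?J x * \<xi> x (h i j) \<partial>\<nu>) = (\<integral>x. ?J x * \<kappa> (n, \<pi>) (h i j) \<partial>\<nu>)"
        by (rule Bochner_Integration.integral_cong) (auto simp: \<Omega>_def indicator_def h)
      also have "\<dots> = complex_of_real \<alpha> * \<kappa> (n, \<pi>) (h i j)"
        by (simp add: \<alpha>_def)
      finally show ?thesis using \<xi>i[OF h] int intJ by simp
    qed
    have Zi: "(\<Sum>i<k. \<Sum>j<k. cnj (c i) * c j * (\<phi> (h i j) - complex_of_real \<alpha> * \<kappa> (n, \<pi>) (h i j))) = integral\<^sup>L \<nu> Z"
    proof -
      have "(\<Sum>i<k. \<Sum>j<k. cnj (c i) * c j * (\<phi> (h i j) - complex_of_real \<alpha> * \<kappa> (n, \<pi>) (h i j))) =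
        (\<Sum>i<k. \<Sum>j<k. cnj (c i) * c j * (\<integral>x. \<xi> x (h i j) - ?J x * \<xi> x (h i j) \<partial>\<nu>))"
        by (intro sum.cong refl) (simp add: val)
      also have "\<dots> = (\<Sum>i<k. \<integral>x. (\<Sum>j<k. cnj (c i) * c j * (\<xi> x (h i j) - ?J x * \<xi> x (h i j))) \<partial>\<nu>)"
        by (intro sum.cong refl, subst Bochner_Integration.integral_sum)
          (auto intro!: int intJ Bochner_Integration.integrable_diff)
      also have "\<dots> = integral\<^sup>L \<nu> Z"
        unfolding Z_def by (subst Bochner_Integration.integral_sum)
          (auto intro!: int intJ Bochner_Integration.integrable_diff Bochner_Integration.integrable_sum)
      finally show ?thesis .
    qed
    have Zpos: "AE x in \<nu>. Im (Z x) = 0 \<and> 0 \<le> Re (Z x)"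
      using \<xi>c
    proof eventually_elim
      case (elim x)
      show ?case
      proof (cases "x \<in> \<Omega> (n, \<pi>)")
        case True
        then show ?thesis by (simp add: Z_def)
      next
        case False
        have "positive_definite G (\<xi> x)" using elim by (simp add: is_character_def is_trace_def)
        from positive_definiteD[OF this, of k g c] g False show ?thesis
          by (simp add: Z_def h_def)
      qed
    qed
    have "Im (integral\<^sup>L \<nu> Z) = (\<integral>x. Im (Z x) \<partial>\<nu>)" using iZ by simp
    also have "\<dots> = 0" by (rule integral_eq_zero_AE) (use Zpos in \<open>auto elim: eventually_mono\<close>)
    finally have im: "Im (integral\<^sup>L \<nu> Z) = 0" .
    have "0 \<le> (\<integral>x. Re (Z x) \<partial>\<nu>)" by (rule integral_nonneg_AE) (use Zpos in \<open>auto elim: eventually_mono\<close>)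
    then have re: "0 \<le> Re (integral\<^sup>L \<nu> Z)" using iZ by simp
    show "Im (\<Sum>i<k. \<Sum>j<k. cnj (c i) * c j * (\<phi> (inv\<^bsub>G\<^esub> (g i) \<otimes>\<^bsub>G\<^esub> g j) -
        complex_of_real \<alpha> * \<kappa> (n, \<pi>) (inv\<^bsub>G\<^esub> (g i) \<otimes>\<^bsub>G\<^esub> g j))) = 0 \<and>
      0 \<le> Re (\<Sum>i<k. \<Sum>j<k. cnj (c i) * c j * (\<phi> (inv\<^bsub>G\<^esub> (g i) \<otimes>\<^bsub>G\<^esub> g j) -
        complex_of_real \<alpha> * \<kappa> (n, \<pi>) (inv\<^bsub>G\<^esub> (g i) \<otimes>\<^bsub>G\<^esub> g j)))"
      using im re Zi unfolding h_def by metis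
  qed
  moreover have "unitary_rep G n \<pi>" "n \<ge> 1" using q(1) S(2) by (auto simp: S'_def)
  ultimately show ?thesis using that[of n \<pi> \<alpha>] \<alpha> by (simp add: \<kappa>_def)
qed

section \<open>Coincidences along orbits\<close>

lemma sum_count_fibres:
  fixes u :: "nat \<Rightarrow> 'x" and f :: "'x \<Rightarrow> real"
  shows "(\<Sum>i<k. f (u i)) = (\<Sum>z\<in>u ` {..<k}. real (card {j. j < k \<and> u j = z}) * f z)"
proof -
  have "(\<Sum>i<k. f (u i)) = (\<Sum>z\<in>u ` {..<k}. \<Sum>i\<in>{i \<in> {..<k}. u i = z}. f (u i))"
    by (rule sum.image_gen) simp
  also have "\<dots> = (\<Sum>z\<in>u ` {..<k}. real (card {j. j < k \<and> u j = z}) * f z)"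
    by (intro sum.cong refl) simp
  finally show ?thesis .
qed

text \<open>Completing the square. The free parameter \<theta> later balances the size of the energy
  against the defect of invariance.\<close>

lemma abs_mult_le_weighted_squares:
  fixes a b \<theta> :: real
  assumes "\<theta> > 0" "a \<ge> 0"
  shows "a * \<bar>b\<bar> \<le> \<theta> / 2 * a\<^sup>2 + b\<^sup>2 / (2 * \<theta>)"
proof -
  have "0 \<le> (\<theta> * a - \<bar>b\<bar>)\<^sup>2 / (2 * \<theta>)" using assms by simp
  also have "\<dots> = \<theta> / 2 * a\<^sup>2 + b\<^sup>2 / (2 * \<theta>) - a * \<bar>b\<bar>"
    using assms by (simp add: power2_diff field_simps power2_eq_square)
  finally show ?thesis by simp
qed

text \<open>\<open>m\<close> is the multiplicity function of the list, Q its squared norm and R its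
  correlation with its translate by \<open>\<tau>\<close>. Injectivity of \<open>\<tau>\<close>
  bounds the squared displacement, summed over the points of the list, by 2 (Q - R). A sum over the
  list weights each point by \<open>m\<close>, so the weighted square inequality passes to the first
  power.\<close>

lemma count_displacement_bound:
  fixes u :: "nat \<Rightarrow> 'x" and \<tau> :: "'x \<Rightarrow> 'x" and k :: nat and \<theta> :: real
  defines "m \<equiv> \<lambda>z. real (card {j. j < k \<and> u j = z})"
  assumes inj: "inj \<tau>" and \<theta>: "\<theta> > 0"
  shows "(\<Sum>i<k. \<bar>m (\<tau> (u i)) - m (u i)\<bar>) \<le>
    \<theta> / 2 * (\<Sum>i<k. m (u i)) + ((\<Sum>i<k. m (u i)) - (\<Sum>i<k. m (\<tau> (u i)))) / \<theta>"
proof -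
  let ?Z = "u ` {..<k}"
  have grp: "(\<Sum>i<k. f (u i)) = (\<Sum>z\<in>?Z. m z * f z)" for f :: "'x \<Rightarrow> real"
    unfolding m_def by (rule sum_count_fibres)
  have m0: "m z \<ge> 0" for z by (simp add: m_def)
  have mZ: "m z = 0" if "z \<notin> ?Z" for z
  proof -
    have "{j. j < k \<and> u j = z} = {}" using that by auto
    then show ?thesis by (simp add: m_def)
  qed
  define Q where "Q = (\<Sum>i<k. m (u i))"
  define R where "R = (\<Sum>i<k. m (\<tau> (u i)))"
  have Q: "Q = (\<Sum>z\<in>?Z. (m z)\<^sup>2)" unfolding Q_def grp by (simp add: power2_eq_square)
  have R: "R = (\<Sum>z\<in>?Z. m z * m (\<tau> z))" unfolding R_def using grp[of "\<lambda>z. m (\<tau> z)"] by simp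
  have "(\<Sum>z\<in>?Z. (m (\<tau> z))\<^sup>2) = (\<Sum>y\<in>\<tau> ` ?Z. (m y)\<^sup>2)"
    using inj by (subst sum.reindex) (auto intro: inj_on_subset)
  also have "\<dots> = (\<Sum>y\<in>\<tau> ` ?Z \<inter> ?Z. (m y)\<^sup>2)"
    by (rule sum.mono_neutral_right) (auto intro: mZ)
  also have "\<dots> \<le> Q" unfolding Q by (rule sum_mono2) auto
  finally have Q2: "(\<Sum>z\<in>?Z. (m (\<tau> z))\<^sup>2) \<le> Q" .
  have "(\<Sum>i<k. \<bar>m (\<tau> (u i)) - m (u i)\<bar>) = (\<Sum>z\<in>?Z. m z * \<bar>m (\<tau> z) - m z\<bar>)"
    using grp[of "\<lambda>z. \<bar>m (\<tau> z) - m z\<bar>"] by simp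
  also have "\<dots> \<le> (\<Sum>z\<in>?Z. \<theta> / 2 * (m z)\<^sup>2 + (m (\<tau> z) - m z)\<^sup>2 / (2 * \<theta>))"
    by (intro sum_mono abs_mult_le_weighted_squares \<theta> m0)
  also have "\<dots> = \<theta> / 2 * Q + (\<Sum>z\<in>?Z. (m (\<tau> z) - m z)\<^sup>2) / (2 * \<theta>)"
    by (simp add: Q sum.distrib sum_distrib_left sum_divide_distrib)
  also have "(\<Sum>z\<in>?Z. (m (\<tau> z) - m z)\<^sup>2) = (\<Sum>z\<in>?Z. (m (\<tau> z))\<^sup>2) + Q - 2 * R"
    by (simp add: Q R power2_diff sum.distrib sum_subtractf sum_distrib_left mult_ac)
  also have "\<theta> / 2 * Q + ((\<Sum>z\<in>?Z. (m (\<tau> z))\<^sup>2) + Q - 2 * R) / (2 * \<theta>) \<le>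
      \<theta> / 2 * Q + (Q + Q - 2 * R) / (2 * \<theta>)"
    using Q2 \<theta> by (intro add_left_mono divide_right_mono) auto
  also have "\<dots> = \<theta> / 2 * Q + (Q - R) / \<theta>" using \<theta> by (simp add: field_simps)
  finally show ?thesis unfolding Q_def R_def .
qed

text \<open>Multiplicities at the distinct points of the image add up to at most k. If all of them
  were \<open>m z\<close>, their sum would be the left side; the displacements pay for the
  difference.\<close>

lemma count_le_of_large_image:
  fixes u :: "nat \<Rightarrow> 'x" and \<tau> :: "'g \<Rightarrow> 'x \<Rightarrow> 'x" and k :: nat
  defines "m \<equiv> \<lambda>z. real (card {j. j < k \<and> u j = z})"
  assumes A: "finite A"
  shows "real (card ((\<lambda>a. \<tau> a z) ` A)) * m z \<le> real k + (\<Sum>a\<in>A. \<bar>m (\<tau> a z) - m z\<bar>)"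
proof -
  let ?I = "(\<lambda>a. \<tau> a z) ` A"
  have "real (card ?I) * m z = (\<Sum>y\<in>?I. m z)" by simp
  also have "\<dots> \<le> (\<Sum>y\<in>?I. m y + \<bar>m y - m z\<bar>)" by (intro sum_mono) linarith
  also have "\<dots> = (\<Sum>y\<in>?I. m y) + (\<Sum>y\<in>?I. \<bar>m y - m z\<bar>)" by (rule sum.distrib)
  also have "(\<Sum>y\<in>?I. m y) \<le> real k"
  proof -
    have "(\<Sum>y\<in>?I. card {j. j < k \<and> u j = y}) = card (\<Union>y\<in>?I. {j. j < k \<and> u j = y})"
      using A by (subst card_UN_disjoint) auto
    also have "\<dots> \<le> card {..<k}" by (rule card_mono) auto
    finally show ?thesis by (simp add: m_def flip: of_nat_sum)
  qed
  also have "(\<Sum>y\<in>?I. \<bar>m y - m z\<bar>) \<le> (\<Sum>a\<in>A. \<bar>m (\<tau> a z) - m z\<bar>)"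
    using sum_image_le[OF A, of "\<lambda>y. \<bar>m y - m z\<bar>" "\<lambda>a. \<tau> a z"] by (simp add: comp_def)
  finally show ?thesis by simp
qed

text \<open>The coincidence kernel is the Gram kernel of the point masses at \<open>u i\<close>; the
  right side is the squared norm of their combination with coefficients \<open>c\<close>.\<close>

lemma coincidence_sum_eq:
  fixes u :: "nat \<Rightarrow> 'x" and c :: "nat \<Rightarrow> complex"
  shows "(\<Sum>i<n. \<Sum>j<n. cnj (c i) * c j * complex_of_real (of_bool (u i = u j))) =
    complex_of_real (\<Sum>z\<in>u ` {..<n}. (cmod (\<Sum>i<n. of_bool (u i = z) * c i))\<^sup>2)"
proof -
  have "complex_of_real (\<Sum>z\<in>u ` {..<n}. (cmod (\<Sum>i<n. of_bool (u i = z) * c i))\<^sup>2) =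
    (\<Sum>z\<in>u ` {..<n}. \<Sum>i<n. \<Sum>j<n. cnj (c i) * c j * (of_bool (u i = z) * of_bool (u j = z)))"
  proof -
    have sq: "complex_of_real ((cmod z)\<^sup>2) = cnj z * z" for z
      unfolding complex_norm_square by (rule mult.commute)
    show ?thesis
      unfolding of_real_sum sq cnj_sum sum_product
      by (intro sum.cong refl) (simp add: of_bool_def)
  qed
  also have "\<dots> = (\<Sum>i<n. \<Sum>j<n. \<Sum>z\<in>u ` {..<n}. cnj (c i) * c j * (of_bool (u i = z) * of_bool (u j = z)))"
    by (subst sum.swap, intro sum.cong refl, rule sum.swap)
  also have "\<dots> = (\<Sum>i<n. \<Sum>j<n. cnj (c i) * c j * complex_of_real (of_bool (u i = u j)))"
  proof (intro sum.cong refl)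
    fix i j assume ij: "i \<in> {..<n}" "j \<in> {..<n}"
    have "(\<Sum>z\<in>u ` {..<n}. cnj (c i) * c j * (of_bool (u i = z) * of_bool (u j = z))) =
       (\<Sum>z\<in>u ` {..<n}. if z = u i then cnj (c i) * c j * of_bool (u j = u i) else 0)"
      by (intro sum.cong refl) auto
    also have "\<dots> = cnj (c i) * c j * complex_of_real (of_bool (u i = u j))"
      using ij by (subst sum.delta) auto
    finally show "(\<Sum>z\<in>u ` {..<n}. cnj (c i) * c j * (of_bool (u i = z) * of_bool (u j = z))) =
      cnj (c i) * c j * complex_of_real (of_bool (u i = u j))" .
  qed
  finally show ?thesis by simp
qed

section \<open>Probability measure preserving actions\<close>

locale pmp_borel_action = group G for G :: "('a, 'b) monoid_scheme" (structure) +
  fixes T :: "'a \<Rightarrow> 'x::polish_space \<Rightarrow> 'x" and M :: "'x measure"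
  assumes countable_G: "countable (carrier G)" and sets_M: "sets M = sets borel"
    and action: "pmp_action G T M"
begin

sublocale prob_space M using action by (simp add: pmp_action_def)

section \<open>Invariance of the measure and coincidence sets\<close>

lemma space_M: "space M = UNIV" using sets_eq_imp_space_eq[OF sets_M] by simp

lemma T_meas: "g \<in> carrier G \<Longrightarrow> T g \<in> M \<rightarrow>\<^sub>M M"
  and T_distr: "g \<in> carrier G \<Longrightarrow> distr M M (T g) = M"
  using action by (auto simp: pmp_action_def)

lemma T_borel: "g \<in> carrier G \<Longrightarrow> T g \<in> borel_measurable M"
  using T_meas measurable_cong_sets[OF refl sets_M] by blast

lemma T_one: "T \<one> x = x"
  and T_mult: "g \<in> carrier G \<Longrightarrow> h \<in> carrier G \<Longrightarrow> T (g \<otimes> h) x = T g (T h x)"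
  using action space_M by (auto simp: pmp_action_def)

lemma T_inv: "g \<in> carrier G \<Longrightarrow> T (inv g) (T g x) = x"
  using T_mult[of "inv g" g x] by (simp add: T_one)

lemma T_inj: "g \<in> carrier G \<Longrightarrow> T g x = T g y \<longleftrightarrow> x = y"
  using T_inv by metis

text \<open>The fixed set of \<open>inv g \<otimes> h\<close> in a form that is symmetric in the two
  elements and unchanged by a common left translation, as suits double sums over a list.\<close>

definition coin :: "'a \<Rightarrow> 'a \<Rightarrow> 'x set" where "coin g h = {x. T g x = T h x}"

lemma coin_sets: 
  assumes "g \<in> carrier G" "h \<in> carrier G"
  shows "coin g h \<in> sets M"
proof -
  have "{x \<in> space M. T g x = T h x} \<in> sets M"
    using T_borel[OF assms(1)] T_borel[OF assms(2)] by measurable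
  then show ?thesis by (simp add: coin_def space_M)
qed

lemma measure_preimage:
  assumes "g \<in> carrier G" "B \<in> sets M"
  shows "T g -` B \<in> sets M" "measure M (T g -` B) = measure M B"
proof -
  show "T g -` B \<in> sets M" using measurable_sets[OF T_meas[OF assms(1)] assms(2)] by (simp add: space_M)
  show "measure M (T g -` B) = measure M B"
    using measure_distr[OF T_meas[OF assms(1)] assms(2)] T_distr[OF assms(1)] by (simp add: space_M)
qed

lemma Fix_eq_coin:
  assumes "g \<in> carrier G" "h \<in> carrier G"
  shows "Fix T M (inv g \<otimes> h) = coin g h"
proof -
  have "T (inv g) (T h x) = x \<longleftrightarrow> T g x = T h x" for x
    using T_inv[OF assms(1)] T_inj[of "inv g" "T h x" "T g x"] assms by auto
  then show ?thesis using assms by (simp add: Fix_def coin_def space_M T_mult)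
qed

lemma coin_mult_left:
  assumes "a \<in> carrier G" "g \<in> carrier G" "h \<in> carrier G"
  shows "coin (a \<otimes> g) (a \<otimes> h) = coin g h"
  using assms by (simp add: coin_def T_mult T_inj)

lemma coin_sym: "coin g h = coin h g" by (auto simp: coin_def)

text \<open>For each \<open>x\<close> the coincidences among the points g_i x form a positive
  definite kernel, and integration preserves this. Conjugation by \<open>h\<close> moves the fixed
  set by \<open>h\<close>, so its measure does not change.\<close>

lemma fixed_point_trace: "is_trace G (\<lambda>g. complex_of_real (measure M (Fix T M g)))"
  unfolding is_trace_def
proof (intro conjI)
  show "positive_definite G (\<lambda>g. complex_of_real (measure M (Fix T M g)))"
  proof (rule positive_definiteI)
    fix n :: nat and c :: "nat \<Rightarrow> complex" and g :: "nat \<Rightarrow> 'a"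
    assume g: "\<And>i. i < n \<Longrightarrow> g i \<in> carrier G"
    let ?s = "\<Sum>i<n. \<Sum>j<n. cnj (c i) * c j * complex_of_real (measure M (Fix T M (inv (g i) \<otimes> g j)))"
    define F where "F x = (\<Sum>z\<in>(\<lambda>i. T (g i) x) ` {..<n}. (cmod (\<Sum>i<n. of_bool (T (g i) x = z) * c i))\<^sup>2)" for x
    have ind: "indicator (coin (g i) (g j)) x = (of_bool (T (g i) x = T (g j) x) :: real)" for i j x
      by (simp add: coin_def indicator_def)
    have int: "integrable M (\<lambda>x. complex_of_real (indicator (coin (g i) (g j)) x))" if "i < n" "j < n" for i j
      using coin_sets[OF g g, OF that] by (intro integrable_of_real integrable_real_indicator) (auto simp: less_top[symmetric])
    have "?s = (\<Sum>i<n. \<Sum>j<n. (\<integral>x. cnj (c i) * c j * complex_of_real (indicator (coin (g i) (g j)) x) \<partial>M))"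
    proof (intro sum.cong refl)
      fix i j assume "i \<in> {..<n}" "j \<in> {..<n}"
      then have ij: "i < n" "j < n" by auto
      have "(\<integral>x. complex_of_real (indicator (coin (g i) (g j)) x) \<partial>M) = complex_of_real (measure M (coin (g i) (g j)))"
        using coin_sets[OF g g, OF ij] by simp
      then show "cnj (c i) * c j * complex_of_real (measure M (Fix T M (inv (g i) \<otimes> g j))) =
        (\<integral>x. cnj (c i) * c j * complex_of_real (indicator (coin (g i) (g j)) x) \<partial>M)"
        using ij g by (simp add: Fix_eq_coin del: integral_of_real)
    qed
    also have "\<dots> = (\<Sum>i<n. \<integral>x. (\<Sum>j<n. cnj (c i) * c j * complex_of_real (indicator (coin (g i) (g j)) x)) \<partial>M)"
      using int by (intro sum.cong refl Bochner_Integration.integral_sum[symmetric] integrable_mult_right) auto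
    also have "\<dots> = (\<integral>x. (\<Sum>i<n. \<Sum>j<n. cnj (c i) * c j * complex_of_real (indicator (coin (g i) (g j)) x)) \<partial>M)"
      using int by (intro Bochner_Integration.integral_sum[symmetric] Bochner_Integration.integrable_sum integrable_mult_right) auto
    also have "\<dots> = (\<integral>x. complex_of_real (F x) \<partial>M)"
      unfolding ind F_def by (subst coincidence_sum_eq) (rule refl)
    also have "\<dots> = complex_of_real (\<integral>x. F x \<partial>M)" by (rule integral_complex_of_real)
    finally have s: "?s = complex_of_real (\<integral>x. F x \<partial>M)" .
    have "0 \<le> (\<integral>x. F x \<partial>M)" by (intro integral_nonneg_AE AE_I2) (simp add: F_def sum_nonneg)
    then show "Im ?s = 0 \<and> 0 \<le> Re ?s" unfolding s by simp
  qed
  show "conj_invariant G (\<lambda>g. complex_of_real (measure M (Fix T M g)))"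
    unfolding conj_invariant_def
  proof (intro ballI)
    fix g h assume gh: "g \<in> carrier G" "h \<in> carrier G"
    have fs: "Fix T M g \<in> sets M" using coin_sets[OF one_closed gh(1)] Fix_eq_coin[OF one_closed gh(1)] gh by simp
    have "T (h \<otimes> g \<otimes> inv h) x = x \<longleftrightarrow> T g (T (inv h) x) = T (inv h) x" for x
    proof -
      have "T (h \<otimes> g \<otimes> inv h) x = T h (T g (T (inv h) x))" using gh by (simp add: T_mult)
      moreover have "T h (T (inv h) x) = x" using T_inv[of "inv h" x] gh by simp
      ultimately show ?thesis using T_inj[OF gh(2), of "T g (T (inv h) x)" "T (inv h) x"] by simp
    qed
    then have "Fix T M (h \<otimes> g \<otimes> inv h) = T (inv h) -` Fix T M g"
      by (auto simp: Fix_def space_M)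
    then show "complex_of_real (measure M (Fix T M (h \<otimes> g \<otimes> inv h))) = complex_of_real (measure M (Fix T M g))"
      using measure_preimage(2)[of "inv h" "Fix T M g"] fs gh by simp
  qed
  show "complex_of_real (measure M (Fix T M \<one>)) = 1"
    using prob_space by (simp add: Fix_def T_one space_M)
qed

text \<open>Points with few images under \<open>A\<close>; for infinite orbits this event becomes negligible as \<open>A\<close> grows.\<close>
definition few :: "'a set \<Rightarrow> nat \<Rightarrow> 'x set" where
  "few A N = {x. card ((\<lambda>a. T a x) ` A) < N}"

text \<open>A point has at least \<open>N\<close> images exactly when the orbit map is injective on
  some \<open>N\<close>-element subset of \<open>A\<close>, which is a finite Boolean combination of
  coincidence sets.\<close>

lemma few_sets:
  assumes A: "finite A" "A \<subseteq> carrier G"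
  shows "few A N \<in> sets M"
proof -
  have "- few A N = (\<Union>B\<in>{B. B \<subseteq> A \<and> card B = N}. \<Inter>b\<in>B. \<Inter>b'\<in>B - {b}. - coin b b')" (is "_ = ?R")
  proof (intro Set.set_eqI iffI)
    fix x assume "x \<in> - few A N"
    then have "N \<le> card ((\<lambda>a. T a x) ` A)" by (simp add: few_def)
    then obtain Y where Y: "Y \<subseteq> (\<lambda>a. T a x) ` A" "card Y = N" using obtain_subset_with_card_n by metis
    obtain B where B: "B \<subseteq> A" "inj_on (\<lambda>a. T a x) B" "Y = (\<lambda>a. T a x) ` B"
      using subset_image_inj[of Y "\<lambda>a. T a x" A] Y(1) by auto
    have "card B = N" using B Y(2) card_image by metis
    then show "x \<in> ?R" using B by (auto simp: coin_def inj_on_def)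
  next
    fix x assume "x \<in> ?R"
    then obtain B where B: "B \<subseteq> A" "card B = N" "x \<in> (\<Inter>b\<in>B. \<Inter>b'\<in>B - {b}. - coin b b')" by auto
    then have "inj_on (\<lambda>a. T a x) B" by (force simp: coin_def inj_on_def)
    then have "N = card ((\<lambda>a. T a x) ` B)" using B(2) card_image by metis
    also have "\<dots> \<le> card ((\<lambda>a. T a x) ` A)" using A B(1) by (intro card_mono image_mono) auto
    finally show "x \<in> - few A N" by (simp add: few_def)
  qed
  moreover have "?R \<in> sets M"
  proof (rule sets.finite_UN)
    show "finite {B. B \<subseteq> A \<and> card B = N}" using A(1) by simp
    fix B assume "B \<in> {B. B \<subseteq> A \<and> card B = N}"
    then have B: "B \<subseteq> carrier G" "finite B" using A by (auto dest: finite_subset)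
    \<comment> \<open>Index sets may be empty here, for \<open>B\<close> with at most one element;
      the intersection is then the whole type, which is the space of \<open>M\<close>.\<close>
    have fin: "(\<Inter>i\<in>I. S i) \<in> sets M" if "finite I" "\<And>i. i \<in> I \<Longrightarrow> S i \<in> sets M" for I :: "'a set" and S
    proof (cases "I = {}")
      case True
      then show ?thesis using sets.top[of M] by (simp add: space_M)
    next
      case False
      then show ?thesis using that by (intro sets.finite_INT) auto
    qed
    have "- coin b b' \<in> sets M" if "b \<in> B" "b' \<in> B" for b b'
      using sets.compl_sets[OF coin_sets[of b b']] that B by (auto simp: space_M Compl_eq_Diff_UNIV)
    then show "(\<Inter>b\<in>B. \<Inter>b'\<in>B - {b}. - coin b b') \<in> sets M"
      using B(2) by (intro fin) auto
  qed
  ultimately have "- few A N \<in> sets M" by simp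
  then have "space M - (- few A N) \<in> sets M" by (rule sets.compl_sets)
  then show ?thesis by (simp add: space_M Compl_eq_Diff_UNIV double_diff)
qed

text \<open>With \<open>w\<^sub>x\<close> the counting measure of \<open>g\<^sub>1 x, \<dots>, g\<^sub>k x\<close>, the energy is the integral over \<open>x\<close> of the squared
  \<open>\<ell>\<^sup>2\<close>-norm of \<open>w\<^sub>x\<close>, and the cross energy is that of the inner product of \<open>w\<^sub>x\<close> with its \<open>a\<close>-translate.\<close>
definition energy :: "nat \<Rightarrow> (nat \<Rightarrow> 'a) \<Rightarrow> real" where
  "energy k g = (\<Sum>i<k. \<Sum>j<k. measure M (coin (g i) (g j)))"

definition cross_energy :: "'a \<Rightarrow> nat \<Rightarrow> (nat \<Rightarrow> 'a) \<Rightarrow> real" where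
  "cross_energy a k g = (\<Sum>i<k. \<Sum>j<k. measure M (coin (a \<otimes> g i) (g j)))"

section \<open>Estimates for the energy of a list of group elements\<close>

lemma energy_le: "energy k g \<le> (real k)\<^sup>2"
proof -
  have "energy k g \<le> (\<Sum>i<k. \<Sum>j<k. 1)" unfolding energy_def by (intro sum_mono prob_le_1)
  then show ?thesis by (simp add: power2_eq_square)
qed

text \<open>The expansion |w + a w|^2 = 2 |w|^2 + 2 <w, a w>, valid because translation by
  \<open>a\<close> preserves coincidences.\<close>

lemma energy_concat:
  assumes a: "a \<in> carrier G" and g: "\<And>i. i < k \<Longrightarrow> g i \<in> carrier G"
  shows "energy (k + k) (\<lambda>i. if i < k then g i else a \<otimes> g (i - k)) = 2 * energy k g + 2 * cross_energy a k g"
proof -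
  have split: "(\<Sum>i<k + k. f i) = (\<Sum>i<k. f i) + (\<Sum>i<k. f (k + i))" for f :: "nat \<Rightarrow> real"
    using sum.union_disjoint[of "{..<k}" "(+) k ` {..<k}" f]
    by (simp add: sum.atLeastLessThan_concat[of 0 k "k + k" f, symmetric] lessThan_atLeast0 sum.shift_bounds_nat_ivl[of f 0 k k, simplified] add.commute)
  have "(\<Sum>i<k. \<Sum>j<k. measure M (coin (g i) (a \<otimes> g j))) = cross_energy a k g"
    unfolding cross_energy_def by (subst sum.swap) (simp add: coin_sym)
  moreover have "(\<Sum>i<k. \<Sum>j<k. measure M (coin (a \<otimes> g i) (a \<otimes> g j))) = energy k g"
    unfolding energy_def using g by (intro sum.cong refl) (simp add: coin_mult_left a)
  ultimately show ?thesis
    by (simp add: energy_def split sum.distrib cross_energy_def)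
qed

text \<open>A point of the list with at least \<open>N\<close> images under \<open>A\<close> has
  small multiplicity by comparison with these images, up to displacement terms controlled by
  \<open>Q - R\<close>. At the other points only the trivial bound k is available, which produces
  the indicator terms.\<close>

lemma energy_pointwise:
  fixes N :: nat and \<theta> :: real
  assumes g: "\<And>i. i < k \<Longrightarrow> g i \<in> carrier G" and A: "finite A" "A \<subseteq> carrier G" and \<theta>: "\<theta> > 0"
  defines "Q \<equiv> \<lambda>x. \<Sum>i<k. \<Sum>j<k. indicator (coin (g i) (g j)) x"
    and "R \<equiv> \<lambda>a x. \<Sum>i<k. \<Sum>j<k. indicator (coin (a \<otimes> g i) (g j)) x"
  shows "real N * Q x \<le> real N * real k * (\<Sum>i<k. indicator (T (g i) -` few A N) x) + (real k)\<^sup>2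
    + (\<Sum>a\<in>A. \<theta> / 2 * Q x + (Q x - R a x) / \<theta>)"
proof -
  define u where "u i = T (g i) x" for i
  define m where "m z = real (card {j. j < k \<and> u j = z})" for z
  have m: "m z = (\<Sum>j<k. of_bool (u j = z))" for z
  proof -
    have "{..<k} \<inter> {j. u j = z} = {j. j < k \<and> u j = z}" by auto
    then show ?thesis by (simp add: m_def)
  qed
  have Q: "Q x = (\<Sum>i<k. m (u i))"
    unfolding Q_def m by (intro sum.cong refl) (auto simp: coin_def u_def)
  have R: "R a x = (\<Sum>i<k. m (T a (u i)))" if "a \<in> A" for a
  proof -
    have "a \<in> carrier G" using that A by auto
    then show ?thesis
      unfolding R_def m using g by (intro sum.cong refl) (auto simp: coin_def u_def T_mult)
  qed
  have mk: "m z \<le> real k" for z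
  proof -
    have "card {j. j < k \<and> u j = z} \<le> card {..<k}" by (rule card_mono) auto
    then show ?thesis by (simp add: m_def)
  qed
  have pt: "real N * m z \<le> real N * real k * indicator (few A N) z + real k + (\<Sum>a\<in>A. \<bar>m (T a z) - m z\<bar>)" for z
  proof (cases "z \<in> few A N")
    case True
    have "real N * m z \<le> real N * real k" by (intro mult_left_mono mk) simp
    moreover have "0 \<le> (\<Sum>a\<in>A. \<bar>m (T a z) - m z\<bar>)" by (intro sum_nonneg) simp
    ultimately have "real N * m z \<le> real N * real k + real k + (\<Sum>a\<in>A. \<bar>m (T a z) - m z\<bar>)" by linarith
    then show ?thesis using True by simp
  next
    case False
    then have "real N * m z \<le> real (card ((\<lambda>a. T a z) ` A)) * m z"
      by (intro mult_right_mono) (auto simp: few_def m_def)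
    also have "\<dots> \<le> real k + (\<Sum>a\<in>A. \<bar>m (T a z) - m z\<bar>)"
      unfolding m_def by (rule count_le_of_large_image[OF A(1)])
    finally show ?thesis using False by simp
  qed
  have "real N * Q x = (\<Sum>i<k. real N * m (u i))" unfolding Q by (rule sum_distrib_left)
  also have "\<dots> \<le> (\<Sum>i<k. real N * real k * indicator (few A N) (u i) + real k + (\<Sum>a\<in>A. \<bar>m (T a (u i)) - m (u i)\<bar>))"
    by (intro sum_mono pt)
  also have "\<dots> = real N * real k * (\<Sum>i<k. indicator (T (g i) -` few A N) x) + (real k)\<^sup>2
    + (\<Sum>i<k. \<Sum>a\<in>A. \<bar>m (T a (u i)) - m (u i)\<bar>)"
    by (simp add: sum.distrib sum_distrib_left power2_eq_square u_def indicator_def)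
  also have "(\<Sum>i<k. \<Sum>a\<in>A. \<bar>m (T a (u i)) - m (u i)\<bar>) = (\<Sum>a\<in>A. \<Sum>i<k. \<bar>m (T a (u i)) - m (u i)\<bar>)"
    by (rule sum.swap)
  also have "\<dots> \<le> (\<Sum>a\<in>A. \<theta> / 2 * Q x + (Q x - R a x) / \<theta>)"
  proof (rule sum_mono)
    fix a assume a: "a \<in> A"
    then have "inj (T a)" using A(2) T_inj by (auto intro!: injI)
    from count_displacement_bound[OF this \<theta>, of k u]
    show "(\<Sum>i<k. \<bar>m (T a (u i)) - m (u i)\<bar>) \<le> \<theta> / 2 * Q x + (Q x - R a x) / \<theta>"
      unfolding Q R[OF a] m_def .
  qed
  finally show ?thesis by simp
qed

text \<open>By invariance of the measure all preimages of \<open>few A N\<close> have the same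
  measure, so the exceptional points cost only that measure at the scale N k^2, whatever the
  list.\<close>

lemma energy_integrated:
  fixes N :: nat and \<theta> :: real
  assumes g: "\<And>i. i < k \<Longrightarrow> g i \<in> carrier G" and A: "finite A" "A \<subseteq> carrier G" and \<theta>: "\<theta> > 0"
  shows "real N * energy k g \<le> real N * (real k)\<^sup>2 * measure M (few A N) + (real k)\<^sup>2
    + (\<Sum>a\<in>A. \<theta> / 2 * energy k g + (energy k g - cross_energy a k g) / \<theta>)"
proof -
  define Q :: "'x \<Rightarrow> real" where "Q x = (\<Sum>i<k. \<Sum>j<k. indicator (coin (g i) (g j)) x)" for x
  define R :: "'a \<Rightarrow> 'x \<Rightarrow> real" where "R a x = (\<Sum>i<k. \<Sum>j<k. indicator (coin (a \<otimes> g i) (g j)) x)" for a x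
  define P :: "'x \<Rightarrow> real" where "P x = (\<Sum>i<k. indicator (T (g i) -` few A N) x)" for x
  have si: "has_bochner_integral M (indicator B) (measure M B)" if "B \<in> sets M" for B
    using that by (intro has_bochner_integral_real_indicator) (auto simp: less_top[symmetric])
  have Q: "has_bochner_integral M Q (energy k g)"
    unfolding Q_def energy_def using g by (intro has_bochner_integral_sum si coin_sets) auto
  have R: "has_bochner_integral M (R a) (cross_energy a k g)" if "a \<in> A" for a
    unfolding R_def cross_energy_def using g that A by (intro has_bochner_integral_sum si coin_sets) auto
  have P: "has_bochner_integral M P (real k * measure M (few A N))"
  proof -
    have "has_bochner_integral M P (\<Sum>i<k. measure M (T (g i) -` few A N))"
      unfolding P_def using g by (intro has_bochner_integral_sum si measure_preimage few_sets A) auto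
    also have "(\<Sum>i<k. measure M (T (g i) -` few A N)) = (\<Sum>i<k. measure M (few A N))"
      using g by (intro sum.cong refl measure_preimage few_sets A) auto
    finally show ?thesis by simp
  qed
  have L: "has_bochner_integral M (\<lambda>x. real N * Q x) (real N * energy k g)"
    by (intro has_bochner_integral_mult_right Q)
  have c: "has_bochner_integral M (\<lambda>x. (real k)\<^sup>2) ((real k)\<^sup>2)"
    using prob_space by (simp add: has_bochner_integral_iff)
  have U: "has_bochner_integral M (\<lambda>x. real N * real k * P x + (real k)\<^sup>2 + (\<Sum>a\<in>A. \<theta> / 2 * Q x + (Q x - R a x) / \<theta>))
    (real N * real k * (real k * measure M (few A N)) + (real k)\<^sup>2
    + (\<Sum>a\<in>A. \<theta> / 2 * energy k g + (energy k g - cross_energy a k g) / \<theta>))"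
    by (intro has_bochner_integral_add has_bochner_integral_sum has_bochner_integral_mult_right
        has_bochner_integral_divide has_bochner_integral_diff P Q R c) 
  have "real N * energy k g \<le> real N * real k * (real k * measure M (few A N)) + (real k)\<^sup>2
    + (\<Sum>a\<in>A. \<theta> / 2 * energy k g + (energy k g - cross_energy a k g) / \<theta>)"
    unfolding has_bochner_integral_integral_eq[OF L, symmetric] has_bochner_integral_integral_eq[OF U, symmetric]
  proof (rule integral_mono)
    show "integrable M (\<lambda>x. real N * Q x)" using L by (rule integrable.intros)
    show "integrable M (\<lambda>x. real N * real k * P x + (real k)\<^sup>2 + (\<Sum>a\<in>A. \<theta> / 2 * Q x + (Q x - R a x) / \<theta>))"
      using U by (rule integrable.intros)
    fix x
    show "real N * Q x \<le> real N * real k * P x + (real k)\<^sup>2 + (\<Sum>a\<in>A. \<theta> / 2 * Q x + (Q x - R a x) / \<theta>)"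
      unfolding Q_def R_def P_def by (rule energy_pointwise[OF g A \<theta>])
  qed
  then show ?thesis by (simp add: power2_eq_square mult_ac)
qed

section \<open>The set of points with finite orbit\<close>

definition finite_orbits :: "'x set" where
  "finite_orbits = {x. finite (orbit G T x)}"

lemma exhaustion:
  obtains A :: "nat \<Rightarrow> 'a set" where "\<And>m. finite (A m)" "incseq A" "(\<Union>m. A m) = carrier G"
proof -
  define e where "e = from_nat_into (carrier G)"
  have "carrier G \<noteq> {}" by auto
  then have "range e = carrier G" unfolding e_def using countable_G by (intro range_from_nat_into)
  then have "(\<Union>m. e ` {..m}) = carrier G" by (auto simp: image_iff) (metis atMost_iff order_refl rangeE)
  then show ?thesis using that[of "\<lambda>m. e ` {..m}"] by (force simp: incseq_def)
qed

lemma few_exhaustion_decseq: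
  assumes "\<And>m. finite (A m)" "incseq A"
  shows "decseq (\<lambda>m. few (A m) N)"
proof (rule decseq_SucI, rule subsetI)
  fix m x assume "x \<in> few (A (Suc m)) N"
  moreover have "card ((\<lambda>a. T a x) ` A m) \<le> card ((\<lambda>a. T a x) ` A (Suc m))"
    using assms by (intro card_mono image_mono) (auto simp: incseq_SucD)
  ultimately show "x \<in> few (A m) N" by (simp add: few_def)
qed

text \<open>\<open>N\<close> points of an infinite orbit are reached by finitely many group
  elements, and these lie in a single \<open>A m\<close> since the exhaustion increases. The formula
  serves both measurability and passage to the limit.\<close>

lemma finite_orbits_eq:
  assumes fin: "\<And>m. finite (A m)" and inc: "incseq A" and un: "(\<Union>m. A m) = carrier G"
  shows "finite_orbits = (\<Union>N. \<Inter>m. few (A m) N)"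
proof (intro Set.set_eqI iffI)
  fix x assume "x \<in> finite_orbits"
  then have f: "finite (orbit G T x)" by (simp add: finite_orbits_def)
  have "card ((\<lambda>a. T a x) ` A m) \<le> card (orbit G T x)" for m
    using un by (intro card_mono f) (auto simp: orbit_def)
  then show "x \<in> (\<Union>N. \<Inter>m. few (A m) N)"
    by (auto simp: few_def intro!: exI[of _ "Suc (card (orbit G T x))"] le_imp_less_Suc)
next
  fix x assume "x \<in> (\<Union>N. \<Inter>m. few (A m) N)"
  then obtain N where N: "\<And>m. card ((\<lambda>a. T a x) ` A m) < N" by (auto simp: few_def)
  show "x \<in> finite_orbits"
  proof (rule ccontr)
    assume "x \<notin> finite_orbits"
    then have "infinite (orbit G T x)" by (simp add: finite_orbits_def)
    then obtain F where F: "finite F" "card F = N" "F \<subseteq> orbit G T x"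
      using infinite_arbitrarily_large by blast
    then obtain B where B: "B \<subseteq> carrier G" "finite B" "F = (\<lambda>a. T a x) ` B"
      unfolding orbit_def using finite_subset_image[OF F(1)] by metis
    have "\<exists>m. B \<subseteq> A m"
    proof (cases "B = {}")
      case False
      have "\<forall>b\<in>B. \<exists>m. b \<in> A m" using B(1) un by auto
      then obtain f where f: "\<And>b. b \<in> B \<Longrightarrow> b \<in> A (f b)" by metis
      have "b \<in> A (Max (f ` B))" if "b \<in> B" for b
        using f[OF that] incseqD[OF inc, of "f b" "Max (f ` B)"] that B(2) by auto
      then show ?thesis by auto
    qed auto
    then obtain m where "B \<subseteq> A m" ..
    then have "card F \<le> card ((\<lambda>a. T a x) ` A m)" unfolding B(3) using fin by (intro card_mono image_mono) auto
    with N[of m] F(2) show False by simp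
  qed
qed

lemma finite_orbits_sets: "finite_orbits \<in> sets M"
proof -
  obtain A where A: "\<And>m. finite (A m)" "incseq A" "(\<Union>m. A m) = carrier G" using exhaustion by blast
  have "A m \<subseteq> carrier G" for m using A(3) by auto
  then show ?thesis unfolding finite_orbits_eq[OF A]
    by (intro sets.countable_UN sets.countable_INT) (auto intro!: few_sets A(1))
qed

text \<open>For fixed \<open>N\<close> the sets \<open>few (A m) N\<close> decrease to a set of
  points with finite orbit, so continuity from above applies.\<close>

lemma small_few:
  assumes "measure M finite_orbits = 0" "\<epsilon> > 0"
  obtains A where "finite A" "A \<subseteq> carrier G" "measure M (few A N) < \<epsilon>"
proof -
  obtain A where A: "\<And>m. finite (A m)" "incseq A" "(\<Union>m. A m) = carrier G" using exhaustion by blast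
  have AG: "A m \<subseteq> carrier G" for m using A(3) by auto
  have fs: "few (A m) N \<in> sets M" for m by (rule few_sets[OF A(1) AG])
  have "(\<lambda>m. measure M (few (A m) N)) \<longlonglongrightarrow> measure M (\<Inter>m. few (A m) N)"
    using fs few_exhaustion_decseq[OF A(1,2)] by (intro finite_Lim_measure_decseq) auto
  moreover have "measure M (\<Inter>m. few (A m) N) = 0"
  proof -
    have "measure M (\<Inter>m. few (A m) N) \<le> measure M finite_orbits"
      by (rule finite_measure_mono[OF _ finite_orbits_sets]) (auto simp: finite_orbits_eq[OF A])
    then show ?thesis using assms(1) by (simp add: measure_le_0_iff)
  qed
  ultimately have "\<forall>\<^sub>F m in sequentially. measure M (few (A m) N) < \<epsilon>"
    using assms(2) by (intro order_tendstoD) auto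
  then obtain m where "measure M (few (A m) N) < \<epsilon>" by (auto simp: eventually_sequentially)
  then show ?thesis using that[OF A(1) AG] by blast
qed

text \<open>Comparing a near-minimiser of the normalised energy with its concatenation with a translate shows, by
  the parallelogram law, that it is nearly invariant under the translations in \<open>A\<close>; near-invariance
  along large sets \<open>A x\<close> forces small energy.\<close>
lemma small_energy:
  assumes inf: "measure M finite_orbits = 0" and \<delta>: "\<delta> > 0"
  obtains k g where "k \<ge> 1" "\<And>i. i < k \<Longrightarrow> g i \<in> carrier G" "energy k g < \<delta> * (real k)\<^sup>2"
proof (rule ccontr)
  note small = that
  assume "\<not> thesis"
  define S where "S = {energy k g / (real k)\<^sup>2 | k g. k \<ge> 1 \<and> (\<forall>i<k. g i \<in> carrier G)}"
  have low: "\<delta> \<le> e" if "e \<in> S" for e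
  proof -
    have "\<exists>k g. e = energy k g / (real k)\<^sup>2 \<and> k \<ge> 1 \<and> (\<forall>i<k. g i \<in> carrier G)"
      using that unfolding S_def by blast
    then obtain k g where kg: "e = energy k g / (real k)\<^sup>2" "k \<ge> 1" "\<forall>i<k. g i \<in> carrier G" by blast
    then have "\<not> energy k g < \<delta> * (real k)\<^sup>2" using \<open>\<not> thesis\<close> small by blast
    moreover have "(real k)\<^sup>2 > 0" using kg(2) by simp
    ultimately show ?thesis unfolding kg(1) by (simp add: pos_le_divide_eq)
  qed
  have ne: "S \<noteq> {}" unfolding S_def using one_closed by (auto intro!: exI[of _ "1::nat"] exI[of _ "\<lambda>_. \<one>"])
  have bdd: "bdd_below S" using low by (auto intro!: bdd_belowI)
  define d where "d = Inf S"
  have d: "d > 0" using cInf_greatest[OF ne low] \<delta> by (simp add: d_def)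
  have dle: "d * (real k)\<^sup>2 \<le> energy k g" if "k \<ge> 1" "\<And>i. i < k \<Longrightarrow> g i \<in> carrier G" for k g
  proof -
    have "energy k g / (real k)\<^sup>2 \<in> S" using that by (auto simp: S_def)
    then have "d \<le> energy k g / (real k)\<^sup>2" unfolding d_def using bdd by (rule cInf_lower)
    then show ?thesis using that(1) by (simp add: field_simps)
  qed
  \<comment> \<open>The final estimate compares N d K with three errors. The bound 1 / N < d / 4
    makes the error K at most a quarter of N d K, and the other two are arranged to be at most a
    quarter each.\<close>
  obtain N' :: nat where N': "1 / real (Suc N') < d / 4" using d nat_approx_posE[of "d / 4"] by auto
  define N where "N = Suc N'"
  obtain A where A: "finite A" "A \<subseteq> carrier G" "measure M (few A N) < d / 4"
    using small_few[OF inf, of "d / 4" N] d by auto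
  \<comment> \<open>These constants are solved backwards from \<theta> / 2 + 2 \<eta> / \<theta> = r
    / 4 and c r \<le> d; the denominator c + 1 covers an empty \<open>A\<close>.\<close>
  define c where "c = real (card A)"
  define r where "r = d / (c + 1)"
  define \<theta> where "\<theta> = r / 4"
  define \<eta> where "\<eta> = r * \<theta> / 16"
  have c: "c \<ge> 0" by (simp add: c_def)
  have \<theta>: "\<theta> > 0" using d c by (simp add: \<theta>_def r_def)
  have \<eta>: "\<eta> > 0" using d c \<theta> by (simp add: \<eta>_def r_def)
  have "\<exists>e\<in>S. e < d + \<eta>" using cInf_lessD[OF ne, of "d + \<eta>"] \<eta> by (simp add: d_def)
  then obtain k g where k: "k \<ge> 1" and g: "\<And>i. i < k \<Longrightarrow> g i \<in> carrier G" and e: "energy k g / (real k)\<^sup>2 < d + \<eta>"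
    by (auto simp: S_def)
  define K where "K = (real k)\<^sup>2"
  have K: "K > 0" using k by (simp add: K_def)
  have e': "energy k g \<le> (d + \<eta>) * K" using e K by (simp add: K_def field_simps)
  \<comment> \<open>The concatenated list has length 2 k, hence energy at least 4 d K, while the
    list itself has energy at most (d + \<eta>) K; the difference is therefore at most 2 \<eta>
    K.\<close>
  have cr: "energy k g - cross_energy a k g \<le> 2 * \<eta> * K" if "a \<in> A" for a
  proof -
    have a: "a \<in> carrier G" using that A by auto
    have "d * (real (k + k))\<^sup>2 \<le> energy (k + k) (\<lambda>i. if i < k then g i else a \<otimes> g (i - k))"
      using k g a by (intro dle) auto
    then have "4 * d * K \<le> 2 * energy k g + 2 * cross_energy a k g"
      using energy_concat[OF a, of k g] g by (simp add: K_def power2_eq_square algebra_simps)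
    then show ?thesis using e' by (simp add: algebra_simps)
  qed
  have "real N * (d * K) \<le> real N * energy k g"
    using dle[OF k g] by (intro mult_left_mono) (auto simp: K_def)
  also have "\<dots> \<le> real N * K * measure M (few A N) + K
    + (\<Sum>a\<in>A. \<theta> / 2 * energy k g + (energy k g - cross_energy a k g) / \<theta>)"
    unfolding K_def by (rule energy_integrated[OF g A(1,2) \<theta>])
  also have "(\<Sum>a\<in>A. \<theta> / 2 * energy k g + (energy k g - cross_energy a k g) / \<theta>) \<le> (\<Sum>a\<in>A. \<theta> / 2 * K + 2 * \<eta> * K / \<theta>)"
    using \<theta> energy_le[of k g] cr by (intro sum_mono add_mono mult_left_mono divide_right_mono) (auto simp: K_def)
  also have "\<dots> = c * (\<theta> / 2 + 2 * \<eta> / \<theta>) * K" by (simp add: c_def algebra_simps)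
  also have "c * (\<theta> / 2 + 2 * \<eta> / \<theta>) \<le> d / 4"
  proof -
    have "2 * \<eta> / \<theta> = r / 8" using \<theta> by (simp add: \<eta>_def)
    then have e: "\<theta> / 2 + 2 * \<eta> / \<theta> = r / 4" by (simp add: \<theta>_def)
    have "c * r \<le> d" using c d by (simp add: r_def field_simps)
    then show ?thesis unfolding e by simp
  qed
  finally have "real N * (d * K) \<le> real N * K * measure M (few A N) + K + d / 4 * K"
    using K by simp
  moreover have "real N * K * measure M (few A N) \<le> real N * K * (d / 4)"
    using A(3) K by (intro mult_left_mono) auto
  moreover have "K \<le> real N * K * (d / 4)"
  proof -
    have "1 \<le> real N * (d / 4)" using N' by (simp add: N_def field_simps)
    then show ?thesis using K mult_right_mono[of 1 "real N * (d / 4)" K] by (simp add: mult_ac)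
  qed
  moreover have "d / 4 * K \<le> real N * K * (d / 4)"
  proof -
    have "1 * (d / 4 * K) \<le> real N * (d / 4 * K)" using d K by (intro mult_right_mono) (auto simp: N_def)
    then show ?thesis by (simp add: mult_ac)
  qed
  ultimately have "real N * K * d \<le> 3 / 4 * (real N * K * d)" by (simp add: algebra_simps)
  moreover have "real N * K * d > 0" using K d by (simp add: N_def)
  ultimately show False by linarith
qed

section \<open>From finite orbits and ergodicity to a single orbit\<close>

lemma orbit_eq:
  assumes g: "g \<in> carrier G"
  shows "orbit G T (T g x) = orbit G T x"
proof -
  have sub: "orbit G T (T h y) \<subseteq> orbit G T y" if "h \<in> carrier G" for h y
    using that by (auto simp: orbit_def T_mult[symmetric])
  have "orbit G T (T (inv g) (T g x)) \<subseteq> orbit G T (T g x)" using g by (intro sub) simp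
  then show ?thesis using sub[OF g, of x] T_inv[OF g] by auto
qed

lemma finite_orbits_invariant:
  "g \<in> carrier G \<Longrightarrow> T g -` finite_orbits \<inter> space M = finite_orbits"
  by (auto simp: finite_orbits_def orbit_eq space_M)

text \<open>Saturations of basic open sets are invariant, so by ergodicity almost all orbits meet
  the same basic open sets. A finite orbit is closed and hence determined by the basic open sets
  that it meets.\<close>

lemma essentially_transitive_if_finite_orbits:
  assumes erg: "ergodic_action G T M" and fin: "measure M finite_orbits = 1"
  shows "essentially_transitive G T M"
proof -
  obtain \<B> :: "'x set set" where \<B>: "countable \<B>" "topological_basis \<B>" by (rule ex_countable_basis[THEN exE]) auto
  define sat where "sat U = (\<Union>g\<in>carrier G. T g -` U)" for U
  have satm: "sat U \<in> sets M" if "U \<in> \<B>" for U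
  proof -
    have "U \<in> sets M" using topological_basis_open[OF \<B>(2) that] by (simp add: sets_M)
    then show ?thesis unfolding sat_def
      using countable_G by (intro sets.countable_UN') (auto intro!: measure_preimage(1))
  qed
  have satinv: "T h -` sat U \<inter> space M = sat U" if h: "h \<in> carrier G" for h U
  proof (intro Set.set_eqI iffI)
    fix x assume "x \<in> T h -` sat U \<inter> space M"
    then obtain g where "g \<in> carrier G" "T g (T h x) \<in> U" by (auto simp: sat_def)
    then show "x \<in> sat U" using h by (auto simp: sat_def T_mult[symmetric] intro!: bexI[of _ "g \<otimes> h"])
  next
    fix x assume "x \<in> sat U"
    then obtain g where g: "g \<in> carrier G" "T g x \<in> U" by (auto simp: sat_def)
    have "T (g \<otimes> inv h) (T h x) = T g x" using g h by (simp add: T_mult T_inv)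
    then show "x \<in> T h -` sat U \<inter> space M"
      using g h by (auto simp: sat_def space_M intro!: bexI[of _ "g \<otimes> inv h"])
  qed
  have "AE x in M. \<forall>U\<in>\<B>. x \<in> sat U \<longleftrightarrow> measure M (sat U) = 1"
  proof (subst AE_ball_countable[OF \<B>(1)], rule ballI)
    fix U assume U: "U \<in> \<B>"
    have "measure M (sat U) = 0 \<or> measure M (sat U) = 1"
      using erg satm[OF U] satinv by (simp add: ergodic_action_def)
    then show "AE x in M. x \<in> sat U \<longleftrightarrow> measure M (sat U) = 1"
    proof
      assume 0: "measure M (sat U) = 0"
      then have "AE x in M. x \<notin> sat U" using prob_eq_0[OF satm[OF U]] by simp
      with 0 show ?thesis by simp
    next
      assume 1: "measure M (sat U) = 1"
      then have "AE x in M. x \<in> sat U" using prob_eq_1[OF satm[OF U]] by simp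
      with 1 show ?thesis by simp
    qed
  qed
  moreover have "AE x in M. x \<in> finite_orbits" using fin prob_eq_1[OF finite_orbits_sets] by simp
  ultimately have ae: "AE x in M. x \<in> finite_orbits \<and> (\<forall>U\<in>\<B>. x \<in> sat U \<longleftrightarrow> measure M (sat U) = 1)"
    by eventually_elim auto
  \<comment> \<open>Any point of this almost sure event will do; its orbit turns out to carry the
    whole measure.\<close>
  obtain x where x: "x \<in> finite_orbits" "\<And>U. U \<in> \<B> \<Longrightarrow> x \<in> sat U \<longleftrightarrow> measure M (sat U) = 1"
    using eventually_happens'[OF _ ae] by (auto simp: ae_filter_eq_bot_iff emeasure_space_1)
  have fo: "finite (orbit G T x)" using x(1) by (simp add: finite_orbits_def)
  then have om: "orbit G T x \<in> sets M" by (simp add: sets_M finite_imp_closed)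
  have "AE y in M. y \<in> orbit G T x"
    using ae
  proof eventually_elim
    case (elim y)
    show ?case
    proof (rule ccontr)
      assume "y \<notin> orbit G T x"
      \<comment> \<open>The complement of the finite orbit of x is open, so some basic neighbourhood
        of y misses that orbit, although the orbits of x and y meet the same basic sets.\<close>
      then obtain U where U: "U \<in> \<B>" "y \<in> U" "U \<subseteq> - orbit G T x"
        using topological_basisE[OF \<B>(2), of "- orbit G T x" y] fo by (auto simp: finite_imp_closed open_Compl)
      have "y \<in> sat U" using U(2) by (auto simp: sat_def T_one intro!: bexI[of _ \<one>])
      then have "x \<in> sat U" using elim U(1) x(2) by simp
      then obtain g where "g \<in> carrier G" "T g x \<in> U" by (auto simp: sat_def)
      then show False using U(3) by (auto simp: orbit_def)
    qed
  qed
  then have "measure M (orbit G T x) = 1" using prob_eq_1[OF om] by simp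
  then show ?thesis using om by (auto simp: essentially_transitive_def space_M)
qed

end

theorem theorem8:
  fixes G :: "('a, 'b) monoid_scheme"
    and T :: "'a \<Rightarrow> 'x::polish_space \<Rightarrow> 'x"
    and M :: "'x measure"
  assumes "group G"
    and "countable (carrier G)"
    and "character_rigid G"
    and "countably_many_fd_reps G"
    and "sets M = sets borel"
    and "pmp_action G T M"
    and "ergodic_action G T M"
  shows "essentially_transitive G T M \<or> (\<forall>g \<in> carrier G - center G. measure M (Fix T M g) = 0)"
proof -
  interpret pmp_borel_action G T M
    using assms by (auto simp: pmp_borel_action_def pmp_borel_action_axioms_def)
  have "\<forall>g\<in>carrier G. T g -` finite_orbits \<inter> space M = finite_orbits"
    using finite_orbits_invariant by blast
  then consider "measure M finite_orbits = 0" | "measure M finite_orbits = 1"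
    using assms(7) finite_orbits_sets by (auto simp: ergodic_action_def)
  then show ?thesis
  proof cases
    case 1
    have "measure M (Fix T M g0) = 0" if g0: "g0 \<in> carrier G - center G" for g0
    proof (rule ccontr)
      assume "measure M (Fix T M g0) \<noteq> 0"
      then obtain n \<pi> and \<alpha> :: real where c: "unitary_rep G n \<pi>" "n \<ge> 1" "\<alpha> > 0"
        "positive_definite G (\<lambda>g. complex_of_real (measure M (Fix T M g)) - complex_of_real \<alpha> * (mat_trace (\<pi> g) / of_nat n))"
        using rigid_trace_finite_dim_component[OF assms(1-4) fixed_point_trace g0] by auto
      \<comment> \<open>The threshold \<alpha> / n^2 is exactly the constant of the lower bound, so
        the strict inequality is contradictory.\<close>
      obtain k g where kg: "k \<ge> 1" "\<And>i. i < k \<Longrightarrow> g i \<in> carrier G"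
        "energy k g < \<alpha> / (real n)\<^sup>2 * (real k)\<^sup>2"
        using small_energy[OF 1, of "\<alpha> / (real n)\<^sup>2"] c(2,3) by auto
      have "\<alpha> * (real k)\<^sup>2 / (real n)\<^sup>2 \<le> (\<Sum>i<k. \<Sum>j<k. measure M (Fix T M (inv\<^bsub>G\<^esub> (g i) \<otimes>\<^bsub>G\<^esub> g j)))"
        by (rule finite_dim_component_lower_bound[OF assms(1) c(1,2) _ c(4)]) (use c(3) kg(2) in auto)
      also have "\<dots> = energy k g"
        unfolding energy_def using kg(2) by (intro sum.cong refl) (simp add: Fix_eq_coin)
      finally show False using kg(3) by simp
    qed
    then show ?thesis by blast
  next
    case 2
    then show ?thesis using essentially_transitive_if_finite_orbits[OF assms(7)] by blast
  qed
qed

end
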